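(* Let $m\ge1$ be an integer and let $\{u_j\},\{\tilde u_j\},\{y_j\}\subset V_h$ and coefficients $\gamma_j^i\in\mathbb{R}$ be generated by the Anderson accelerated Newton iteration with depth $m$ (defined in the context). For every step $k>m$ such that $\gamma_k^m\neq0$ and $u_j\in B(0,R)$ for all $j\le k$, where $R<\nu M^{-1}$, the residuals satisfy $$\|\nabla y_{k+1}\|\le\mathcal{O}\left(\left(\sum_{i=1}^m\|\nabla y_{k-i+1}\|\right)^{3/2}\right),$$ i.e. $\|\nabla y_{k+1}\|\le C\big(\sum_{i=1}^m\|\nabla y_{k-i+1}\|\big)^{3/2}$, where the constant $C$ in the bound depends on the parameters $\nu,|\Omega|,R,f,\gamma_k^i$ ($1\le i\le m$) and $\theta_k$, with $\theta_k=\big\|\nabla\big((1-\sum_{i=1}^{m}\gamma_k^i)y_k+\sum_{i=1}^{m}\gamma_k^iy_{k-i}\big)\big\|/\|\nabla y_k\|$.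
   Context: Setting. $\Omega\subset\mathbb{R}^d$ ($d=2,3$) is a simply connected domain that is a convex polytope or has smooth boundary; $(\cdot,\cdot)$ and $\|\cdot\|$ are the $L^2(\Omega)$ inner product and norm; $X=H_0^1(\Omega)^d$, $Q=L^2_0(\Omega)$; $\nu>0$; $f$ is a given forcing with dual norm $\|f\|_{-1}=\sup_{0\ne v\in X}(f,v)/\|\nabla v\|$. $X_h\subset X$, $Q_h\subset Q$ are finite-dimensional finite element spaces satisfying the discrete inf-sup condition, and $V_h=\{v\in X_h: (\nabla\cdot v,q)=0\ \forall q\in Q_h\}$. The trilinear form is $b(u,v,w)=\frac12\big((u\cdot\nabla v,w)-(u\cdot\nabla w,v)\big)$; it satisfies $b(u,v,v)=0$ and $b(u,v,w)\le M\|\nabla u\|\|\nabla v\|\|\nabla w\|$ for all $u,v,w\in X$, with a constant $M>0$ depending only on $|\Omega|$. The small data condition $\nu^{-2}M\|f\|_{-1}<1$ is assumed throughout. For $R<\nu M^{-1}$ let $B(0,R)=\{v\in V_h:\|\nabla v\|\le R\}$. For $u\in B(0,R)$, $G(u)\in V_h$ denotes the unique solution of $$b(u,G(u),v)+b(G(u),u,v)-b(u,u,v)+\nu(\nabla G(u),\nabla v)=(f,v)\quad\forall v\in V_h$$ (the Newton solution operator for the stationary Navier-Stokes equations). Anderson accelerated Newton iteration with depth $m$. Step 0: choose $u_0\in B(0,R)$. Step 1: $\tilde u_1=G(u_0)$, $y_1=\tilde u_1-u_0$, $u_1=\tilde u_1$. Step $k$, $k=2,3,\dots$: set $m_k=\min\{k-1,m\}$;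 (a) $\tilde u_k=G(u_{k-1})$, $y_k=\tilde u_k-u_{k-1}$; (b) find $\{\gamma_k^i\}_{i=1}^{m_k}\subset\mathbb{R}$ minimizing $\big\|\nabla\big((1-\sum_{i=1}^{m_k}\gamma_k^i)y_k+\sum_{i=1}^{m_k}\gamma_k^iy_{k-i}\big)\big\|$; (c) $u_k=(1-\sum_{i=1}^{m_k}\gamma_k^i)\tilde u_k+\sum_{i=1}^{m_k}\gamma_k^i\tilde u_{k-i}$. *)

theory Defs
  imports "HOL-Analysis.Analysis"
begin

section \<open>Smooth functions and domains\<close>

definition pd :: "'d \<Rightarrow> (real^'d \<Rightarrow> real) \<Rightarrow> real^'d \<Rightarrow> real" where
  "pd j f x = frechet_derivative f (at x) (axis j 1)"

primrec iter_pd :: "'d list \<Rightarrow> (real^'d \<Rightarrow> real) \<Rightarrow> real^'d \<Rightarrow> real" where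
  "iter_pd [] f = f"
| "iter_pd (j # js) f = pd j (iter_pd js f)"

text \<open>For open \<open>U\<close> this is $C^\infty(U)$: a function is smooth iff all its iterated partial
  derivatives exist and are (Frechet) differentiable.\<close>

definition smooth_on :: "(real^'d) set \<Rightarrow> (real^'d \<Rightarrow> real) \<Rightarrow> bool" where
  "smooth_on U f \<longleftrightarrow> (\<forall>js. iter_pd js f differentiable_on U)"

text \<open>Local defining functions: near each boundary point, \<open>\<Omega>\<close> is the strict sublevel set of a
  smooth function whose gradient does not vanish.\<close>

definition smooth_boundary :: "(real^'d) set \<Rightarrow> bool" where
  "smooth_boundary \<Omega> \<longleftrightarrow>
    (\<forall>x\<in>frontier \<Omega>. \<exists>U \<rho>. open U \<and> x \<in> U \<and> smooth_on U \<rho> \<and>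
        (\<forall>y\<in>U. \<exists>j. pd j \<rho> y \<noteq> 0) \<and> \<Omega> \<inter> U = {y \<in> U. \<rho> y < 0})"

text \<open>\<open>polytope\<close> is the closed convex hull of a finite set, so the open domain is its interior.\<close>

definition flow_domain :: "(real^'d) set \<Rightarrow> bool" where
  "flow_domain \<Omega> \<longleftrightarrow>
    open \<Omega> \<and> \<Omega> \<noteq> {} \<and> bounded \<Omega> \<and> connected \<Omega> \<and> simply_connected \<Omega> \<and>
    ((\<exists>P. polytope P \<and> \<Omega> = interior P) \<or> smooth_boundary \<Omega>)"


section \<open>Square-integrable functions\<close>

text \<open>Elements of function spaces are represented by functions on the whole space whose values
  outside \<open>\<Omega>\<close> are irrelevant; elements that agree almost everywhere in \<open>\<Omega>\<close> represent the same
  vector. For matrix-valued functions the inner product below is the Frobenius one.\<close>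

definition L2 :: "(real^'d) set \<Rightarrow> (real^'d \<Rightarrow> 'b::euclidean_space) set" where
  "L2 \<Omega> = {f \<in> borel_measurable (lebesgue_on \<Omega>). integrable (lebesgue_on \<Omega>) (\<lambda>x. (norm (f x))\<^sup>2)}"

definition ip :: "(real^'d) set \<Rightarrow> (real^'d \<Rightarrow> 'b::euclidean_space) \<Rightarrow> (real^'d \<Rightarrow> 'b) \<Rightarrow> real" where
  "ip \<Omega> f g = (LINT x|lebesgue_on \<Omega>. f x \<bullet> g x)"

definition L2norm :: "(real^'d) set \<Rightarrow> (real^'d \<Rightarrow> 'b::euclidean_space) \<Rightarrow> real" where
  "L2norm \<Omega> f = sqrt (ip \<Omega> f f)"

definition nonzero_on :: "(real^'d) set \<Rightarrow> (real^'d \<Rightarrow> 'b::euclidean_space) \<Rightarrow> bool" where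
  "nonzero_on \<Omega> f \<longleftrightarrow> \<not> (AE x in lebesgue_on \<Omega>. f x = 0)"

text \<open>$L^2_0(\Omega)$\<close>

definition L20 :: "(real^'d) set \<Rightarrow> (real^'d \<Rightarrow> real) set" where
  "L20 \<Omega> = {q \<in> L2 \<Omega>. (LINT x|lebesgue_on \<Omega>. q x) = 0}"


section \<open>Sobolev spaces\<close>

definition test_fun :: "(real^'d) set \<Rightarrow> (real^'d \<Rightarrow> real) set" where
  "test_fun \<Omega> = {\<phi>. smooth_on UNIV \<phi> \<and>
     compact (closure {x. \<phi> x \<noteq> 0}) \<and> closure {x. \<phi> x \<noteq> 0} \<subseteq> \<Omega>}"

definition weak_pd :: "(real^'d) set \<Rightarrow> 'd \<Rightarrow> (real^'d \<Rightarrow> real) \<Rightarrow> (real^'d \<Rightarrow> real) \<Rightarrow> bool" where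
  "weak_pd \<Omega> j f g \<longleftrightarrow> (\<forall>\<phi>\<in>test_fun \<Omega>. ip \<Omega> f (pd j \<phi>) = - ip \<Omega> g \<phi>)"

definition H1 :: "(real^'d) set \<Rightarrow> (real^'d \<Rightarrow> real) set" where
  "H1 \<Omega> = {f \<in> L2 \<Omega>. \<forall>j. \<exists>g\<in>L2 \<Omega>. weak_pd \<Omega> j f g}"

text \<open>A representative of the weak partial derivative, which is unique up to null sets.\<close>

definition wpd :: "(real^'d) set \<Rightarrow> 'd \<Rightarrow> (real^'d \<Rightarrow> real) \<Rightarrow> real^'d \<Rightarrow> real" where
  "wpd \<Omega> j f = (SOME g. g \<in> L2 \<Omega> \<and> weak_pd \<Omega> j f g)"

definition H1norm :: "(real^'d) set \<Rightarrow> (real^'d \<Rightarrow> real) \<Rightarrow> real" where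
  "H1norm \<Omega> f = sqrt ((L2norm \<Omega> f)\<^sup>2 + (\<Sum>j\<in>UNIV. (L2norm \<Omega> (wpd \<Omega> j f))\<^sup>2))"

text \<open>$H^1_0(\Omega)$ is the $H^1$-closure of the test functions.\<close>

definition H10 :: "(real^'d) set \<Rightarrow> (real^'d \<Rightarrow> real) set" where
  "H10 \<Omega> = {f \<in> H1 \<Omega>. \<exists>\<phi>. (\<forall>n::nat. \<phi> n \<in> test_fun \<Omega>) \<and>
     (\<lambda>n. H1norm \<Omega> (\<lambda>x. \<phi> n x - f x)) \<longlonglongrightarrow> 0}"

text \<open>The velocity space $X = H^1_0(\Omega)^d$.\<close>

definition X :: "(real^'d) set \<Rightarrow> (real^'d \<Rightarrow> real^'d) set" where
  "X \<Omega> = {v. \<forall>i. (\<lambda>x. v x $ i) \<in> H10 \<Omega>}"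

definition grad :: "(real^'d) set \<Rightarrow> (real^'d \<Rightarrow> real^'d) \<Rightarrow> real^'d \<Rightarrow> real^'d^'d" where
  "grad \<Omega> v x = (\<chi> i j. wpd \<Omega> j (\<lambda>z. v z $ i) x)"

definition divg :: "(real^'d) set \<Rightarrow> (real^'d \<Rightarrow> real^'d) \<Rightarrow> real^'d \<Rightarrow> real" where
  "divg \<Omega> v x = trace (grad \<Omega> v x)"

definition gnorm :: "(real^'d) set \<Rightarrow> (real^'d \<Rightarrow> real^'d) \<Rightarrow> real" where
  "gnorm \<Omega> v = L2norm \<Omega> (grad \<Omega> v)"


section \<open>The forcing and the trilinear form\<close>

text \<open>The forcing is an element of the dual space $H^{-1}(\Omega)^d$ of \<open>X \<Omega>\<close>, and $(f,v)$ is the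
  duality pairing \<open>f v\<close>. Square-integrable forcings are the special case \<open>ip \<Omega> f0\<close>.\<close>

definition dual_elem :: "(real^'d) set \<Rightarrow> ((real^'d \<Rightarrow> real^'d) \<Rightarrow> real) \<Rightarrow> bool" where
  "dual_elem \<Omega> f \<longleftrightarrow>
    (\<forall>u\<in>X \<Omega>. \<forall>v\<in>X \<Omega>. \<forall>a b. f (\<lambda>x. a *\<^sub>R u x + b *\<^sub>R v x) = a * f u + b * f v) \<and>
    (\<exists>K. \<forall>v\<in>X \<Omega>. \<bar>f v\<bar> \<le> K * gnorm \<Omega> v)"

definition dual_norm :: "(real^'d) set \<Rightarrow> ((real^'d \<Rightarrow> real^'d) \<Rightarrow> real) \<Rightarrow> real" where
  "dual_norm \<Omega> f = (SUP v\<in>{v \<in> X \<Omega>. nonzero_on \<Omega> v}. f v / gnorm \<Omega> v)"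

text \<open>$(u\cdot\nabla v)_i = \sum_j u_j\, \partial_j v_i$\<close>

definition convect :: "(real^'d) set \<Rightarrow> (real^'d \<Rightarrow> real^'d) \<Rightarrow> (real^'d \<Rightarrow> real^'d) \<Rightarrow> real^'d \<Rightarrow> real^'d" where
  "convect \<Omega> u v x = grad \<Omega> v x *v u x"

definition tri :: "(real^'d) set \<Rightarrow> (real^'d \<Rightarrow> real^'d) \<Rightarrow> (real^'d \<Rightarrow> real^'d) \<Rightarrow> (real^'d \<Rightarrow> real^'d) \<Rightarrow> real" where
  "tri \<Omega> u v w = 1/2 * (ip \<Omega> (convect \<Omega> u v) w - ip \<Omega> (convect \<Omega> u w) v)"

text \<open>The form is well defined and bounded on \<open>X\<close> with constant \<open>M\<close>. Well-definedness has to be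
  spelled out because the library's integral of a non-integrable function is \<open>0\<close>.\<close>

definition tri_bound :: "(real^'d) set \<Rightarrow> real \<Rightarrow> bool" where
  "tri_bound \<Omega> M \<longleftrightarrow> 0 < M \<and>
    (\<forall>u\<in>X \<Omega>. \<forall>v\<in>X \<Omega>. \<forall>w\<in>X \<Omega>.
       integrable (lebesgue_on \<Omega>) (\<lambda>x. convect \<Omega> u v x \<bullet> w x) \<and>
       tri \<Omega> u v w \<le> M * gnorm \<Omega> u * gnorm \<Omega> v * gnorm \<Omega> w)"


section \<open>Discrete spaces\<close>

definition fin_dim_space :: "('a \<Rightarrow> 'b::real_vector) set \<Rightarrow> bool" where
  "fin_dim_space S \<longleftrightarrow> (\<exists>B. finite B \<and> S = {\<lambda>x. \<Sum>b\<in>B. c b *\<^sub>R b x | c. True})"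

text \<open>The supremum is taken in the extended reals, where it is $-\infty$ if \<open>Xh\<close> is trivial.\<close>

definition inf_sup :: "(real^'d) set \<Rightarrow> (real^'d \<Rightarrow> real^'d) set \<Rightarrow> (real^'d \<Rightarrow> real) set \<Rightarrow> bool" where
  "inf_sup \<Omega> Xh Qh \<longleftrightarrow> (\<exists>\<beta>>0. \<forall>q\<in>{q \<in> Qh. nonzero_on \<Omega> q}.
     ereal \<beta> \<le> (SUP v\<in>{v \<in> Xh. nonzero_on \<Omega> v}.
       ereal (ip \<Omega> (divg \<Omega> v) q / (L2norm \<Omega> q * gnorm \<Omega> v))))"

definition Vh :: "(real^'d) set \<Rightarrow> (real^'d \<Rightarrow> real^'d) set \<Rightarrow> (real^'d \<Rightarrow> real) set \<Rightarrow> (real^'d \<Rightarrow> real^'d) set" where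
  "Vh \<Omega> Xh Qh = {v \<in> Xh. \<forall>q\<in>Qh. ip \<Omega> (divg \<Omega> v) q = 0}"

definition ballV :: "(real^'d) set \<Rightarrow> (real^'d \<Rightarrow> real^'d) set \<Rightarrow> real \<Rightarrow> (real^'d \<Rightarrow> real^'d) set" where
  "ballV \<Omega> V R = {v \<in> V. gnorm \<Omega> v \<le> R}"


section \<open>Anderson accelerated Newton iteration\<close>

text \<open>\<open>newton_sol \<Omega> \<nu> f V u w\<close> says $w = G(u)$. It is a relation because, on representatives, the
  unique solution of the linear problem is determined only up to null sets.\<close>

definition newton_sol :: "(real^'d) set \<Rightarrow> real \<Rightarrow> ((real^'d \<Rightarrow> real^'d) \<Rightarrow> real) \<Rightarrow> (real^'d \<Rightarrow> real^'d) set
    \<Rightarrow> (real^'d \<Rightarrow> real^'d) \<Rightarrow> (real^'d \<Rightarrow> real^'d) \<Rightarrow> bool" where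
  "newton_sol \<Omega> \<nu> f V u w \<longleftrightarrow> w \<in> V \<and>
    (\<forall>v\<in>V. tri \<Omega> u w v + tri \<Omega> w u v - tri \<Omega> u u v + \<nu> * ip \<Omega> (grad \<Omega> w) (grad \<Omega> v) = f v)"

definition aa_comb :: "nat \<Rightarrow> (nat \<Rightarrow> real) \<Rightarrow> nat \<Rightarrow> (nat \<Rightarrow> 'a \<Rightarrow> 'b::real_vector) \<Rightarrow> 'a \<Rightarrow> 'b" where
  "aa_comb n c k z = (\<lambda>x. (1 - (\<Sum>i=1..n. c i)) *\<^sub>R z k x + (\<Sum>i=1..n. c i *\<^sub>R z (k - i) x))"

text \<open>Steps \<open>0, \<dots>, N\<close> of the iteration with depth \<open>m\<close>; \<open>\<gamma> k i\<close> is $\gamma_k^i$. The run is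
  truncated at \<open>N\<close> so that nothing is asked of later iterates, which may leave the ball on
  which \<open>G\<close> is defined.\<close>

definition aa_newton :: "(real^'d) set \<Rightarrow> real \<Rightarrow> ((real^'d \<Rightarrow> real^'d) \<Rightarrow> real) \<Rightarrow> (real^'d \<Rightarrow> real^'d) set
    \<Rightarrow> real \<Rightarrow> nat \<Rightarrow> nat \<Rightarrow> (nat \<Rightarrow> real^'d \<Rightarrow> real^'d) \<Rightarrow> (nat \<Rightarrow> real^'d \<Rightarrow> real^'d)
    \<Rightarrow> (nat \<Rightarrow> real^'d \<Rightarrow> real^'d) \<Rightarrow> (nat \<Rightarrow> nat \<Rightarrow> real) \<Rightarrow> bool" where
  "aa_newton \<Omega> \<nu> f V R m N u ut y \<gamma> \<longleftrightarrow>
    u 0 \<in> ballV \<Omega> V R \<and>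
    (\<forall>k\<in>{1..N}. newton_sol \<Omega> \<nu> f V (u (k - 1)) (ut k) \<and> y k = (\<lambda>x. ut k x - u (k - 1) x)) \<and>
    (1 \<le> N \<longrightarrow> u 1 = ut 1) \<and>
    (\<forall>k\<in>{2..N}. let mk = min (k - 1) m in
       (\<forall>c. gnorm \<Omega> (aa_comb mk (\<gamma> k) k y) \<le> gnorm \<Omega> (aa_comb mk c k y)) \<and>
       u k = aa_comb mk (\<gamma> k) k ut)"

text \<open>The gain $\theta_k$ of the optimization step (for $k > m$, where $m_k = m$).\<close>

definition gain :: "(real^'d) set \<Rightarrow> nat \<Rightarrow> (nat \<Rightarrow> nat \<Rightarrow> real) \<Rightarrow> (nat \<Rightarrow> real^'d \<Rightarrow> real^'d) \<Rightarrow> nat \<Rightarrow> real" where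
  "gain \<Omega> m \<gamma> y k = gnorm \<Omega> (aa_comb m (\<gamma> k) k y) / gnorm \<Omega> (y k)"

end

theory Submission
  imports Defs
begin

text \<open>Let \<open>r(u)(v) = f(v) - b(u,u,v) - \<nu>(\<nabla>u,\<nabla>v)\<close>. Because \<open>r\<close> is quadratic, a Newton step
  \<open>G(u) = u + y\<close> leaves exactly \<open>r(G(u)) = - b(y,y,\<cdot>)\<close>, and at an affine combination
  \<open>s = \<Sum> \<alpha>\<^sub>j w\<^sub>j\<close> one has \<open>r(s) = \<Sum> \<alpha>\<^sub>j (r(w\<^sub>j) + b(w\<^sub>j - s, w\<^sub>j - s, \<cdot>))\<close>. On the ball of radius
  \<open>R < \<nu>/M\<close> the operator \<open>-r\<close> is strongly monotone, so the distance of two iterates is bounded by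
  the sum of the sizes of their updates; hence the update following the mixing step is bounded by a
  multiple of \<open>T\<^sup>2\<close>, where \<open>T\<close> bounds the updates \<open>y k, \<dots>, y (k - m)\<close>. The oldest of these is not part
  of the sum \<open>S\<close> in the theorem, but optimality of the combination and \<open>\<gamma> k m \<noteq> 0\<close> bound it by a
  multiple of \<open>S\<close>. This gives a quadratic bound, and \<open>S\<^sup>2 \<le> C S powr (3/2)\<close> since updates are bounded in terms
  of \<open>\<nu>\<close>, \<open>M\<close> and \<open>R\<close> only, by the small data condition.

  With the weak derivative given by a choice among representatives, even the linearity of the
  gradient needs the fundamental lemma of the calculus of variations.\<close>

section \<open>Bump functions and the fundamental lemma of the calculus of variations\<close>

text \<open>For \<open>p = 1\<close> this is the classical smooth function exp(-1/t), extended by 0.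
  The polynomial factor in 1/t makes the family closed under differentiation.\<close>

definition flat :: "real poly \<Rightarrow> real \<Rightarrow> real" where
  "flat p t = (if t > 0 then poly p (1 / t) * exp (- (1 / t)) else 0)"

lemma tendsto_poly_exp_minus: "((\<lambda>s. poly p s * exp (- s)) \<longlongrightarrow> (0::real)) at_top"
proof -
  have "((\<lambda>s. \<Sum>i\<le>degree p. coeff p i * (s ^ i / exp s)) \<longlongrightarrow> (\<Sum>i\<le>degree p. coeff p i * 0)) at_top"
    by (intro tendsto_intros tendsto_power_div_exp_0)
  then show ?thesis
    by (simp add: poly_altdef sum_divide_distrib exp_minus divide_inverse sum_distrib_right mult.assoc)
qed

text \<open>For t > 0 put s = 1/t: then d/dt = -s^2 d/ds, and d/ds sends p(s) exp(-s) to (p' - p)(s)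
  exp(-s), so the new polynomial is s^2 (p - p'). At 0 the exponential decay beats every
  polynomial.\<close>

lemma flat_has_derivative:
  "(flat p has_real_derivative flat ([:0, 0, 1:] * (p - pderiv p)) t) (at t)"
proof -
  consider "t < 0" | "t > 0" | "t = 0" by linarith
  then show ?thesis
  proof cases
    case 1
    have "((\<lambda>_. 0) has_real_derivative 0) (at t)" by simp
    moreover have "\<forall>\<^sub>F x in nhds t. flat p x = 0"
      using eventually_nhds_in_open[of "{..<0}" t] 1 by (auto elim!: eventually_mono simp: flat_def)
    ultimately have "(flat p has_real_derivative 0) (at t)"
      by (simp add: DERIV_cong_ev[OF refl _ refl])
    then show ?thesis using 1 by (simp add: flat_def)
  next
    case 2
    have "((\<lambda>t. poly p (1 / t) * exp (- (1 / t))) has_real_derivative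
       flat ([:0, 0, 1:] * (p - pderiv p)) t) (at t)"
      using 2 by (auto simp: flat_def field_simps power2_eq_square intro!: derivative_eq_intros)
    moreover have "\<forall>\<^sub>F x in nhds t. flat p x = poly p (1 / x) * exp (- (1 / x))"
      using eventually_nhds_in_open[of "{0<..}" t] 2 by (auto elim!: eventually_mono simp: flat_def)
    ultimately show ?thesis
      by (simp only: DERIV_cong_ev[OF refl _ refl])
  next
    case 3
    have r: "((\<lambda>h. flat p h / h) \<longlongrightarrow> 0) (at_right 0)"
    proof -
      \<comment> \<open>\<open>pCons 0 p\<close> is the polynomial s p(s); with s = 1/h the extra
        factor s is the division by h in the difference quotient.\<close>
      have "((\<lambda>h. poly (pCons 0 p) (inverse h) * exp (- inverse h)) \<longlongrightarrow> (0::real)) (at_right 0)"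
        by (rule filterlim_compose[OF tendsto_poly_exp_minus filterlim_inverse_at_top_right])
      then show ?thesis
        by (rule Lim_transform_eventually)
          (auto simp: eventually_at_right_field flat_def field_simps intro!: exI[of _ 1])
    qed
    have "((\<lambda>h. flat p h / h) \<longlongrightarrow> 0) (at_left 0)"
      by (rule Lim_transform_eventually[of "\<lambda>_. 0"])
        (auto simp: eventually_at_left_field flat_def intro!: exI[of _ "-1"])
    with r have "((\<lambda>h. flat p h / h) \<longlongrightarrow> 0) (at 0)"
      by (simp add: filterlim_split_at)
    then have "(flat p has_real_derivative 0) (at 0)"
      by (simp add: DERIV_def flat_def)
    then show ?thesis using 3 by (simp add: flat_def)
  qed
qed

text \<open>An algebra closed under partial derivatives. All its members are therefore smooth as
  soon as each of them is differentiable once.\<close>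

inductive_set bump_alg :: "(real^'d \<Rightarrow> real) set" where
  const: "(\<lambda>x. c) \<in> bump_alg"
| flat: "(\<lambda>x. flat p (s * (x $ i - a))) \<in> bump_alg"
| add: "f \<in> bump_alg \<Longrightarrow> g \<in> bump_alg \<Longrightarrow> (\<lambda>x. f x + g x) \<in> bump_alg"
| mult: "f \<in> bump_alg \<Longrightarrow> g \<in> bump_alg \<Longrightarrow> (\<lambda>x. f x * g x) \<in> bump_alg"

lemma pd_eqI: "(\<And>x. (f has_derivative f' x) (at x)) \<Longrightarrow> pd j f = (\<lambda>x. f' x (axis j 1))"
  unfolding pd_def using frechet_derivative_at by metis

lemma differentiable_frechet:
  "f differentiable (at x) \<Longrightarrow> (f has_derivative frechet_derivative f (at x)) (at x)"
  by (simp add: frechet_derivative_works)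

lemma bump_alg_pd:
  fixes f :: "real^'d \<Rightarrow> real"
  shows "f \<in> bump_alg \<Longrightarrow> (\<forall>x. f differentiable (at x)) \<and> (\<forall>j. pd j f \<in> bump_alg)"
proof (induction rule: bump_alg.induct)
  case (const c)
  have "pd j (\<lambda>x. c) = (\<lambda>x::real^'d. 0)" for j
    by (rule pd_eqI) auto
  then show ?case by (auto intro: bump_alg.const)
next
  case (flat p s i a)
  let ?q = "[:0, 0, 1:] * (p - pderiv p)"
  have d: "((\<lambda>x::real^'d. flat p (s * (x $ i - a))) has_derivative
      (\<lambda>h. h $ i * s * flat ?q (s * (x $ i - a)))) (at x)" for x
  proof -
    have "((\<lambda>x::real^'d. s * (x $ i - a)) has_derivative (\<lambda>h. s * (h $ i))) (at x)"
      by (auto intro!: derivative_eq_intros bounded_linear.has_derivative[OF bounded_linear_vec_nth])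
    from has_derivative_compose[OF this flat_has_derivative[unfolded has_field_derivative_def]]
    show ?thesis by (simp add: mult_ac)
  qed
  have "pd j (\<lambda>x. flat p (s * (x $ i - a))) =
      (\<lambda>x::real^'d. (axis j 1 $ i * s) * flat ?q (s * (x $ i - a)))" for j
    by (rule pd_eqI) (rule d)
  then show ?case using d by (auto simp: differentiable_def intro!: bump_alg.intros)
next
  case (add f g)
  have d: "((\<lambda>x. f x + g x) has_derivative
     (\<lambda>h. frechet_derivative f (at x) h + frechet_derivative g (at x) h)) (at x)" for x
    using add by (intro has_derivative_add differentiable_frechet) auto
  have "pd j (\<lambda>x. f x + g x) = (\<lambda>x. pd j f x + pd j g x)" for j
    unfolding pd_def[of j f] pd_def[of j g] by (rule pd_eqI) (rule d)
  then show ?case using add d by (auto simp: differentiable_def intro: bump_alg.add)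
next
  case (mult f g)
  have d: "((\<lambda>x. f x * g x) has_derivative
     (\<lambda>h. f x * frechet_derivative g (at x) h + frechet_derivative f (at x) h * g x)) (at x)" for x
    using mult by (intro has_derivative_mult differentiable_frechet) auto
  have "pd j (\<lambda>x. f x * g x) = (\<lambda>x. f x * pd j g x + pd j f x * g x)" for j
    unfolding pd_def[of j f] pd_def[of j g] by (rule pd_eqI) (rule d)
  then show ?case using mult d
    by (auto simp: differentiable_def intro!: bump_alg.add bump_alg.mult)
qed

lemma smooth_on_bump_alg:
  assumes "f \<in> bump_alg" shows "smooth_on UNIV f"
proof -
  have "iter_pd js f \<in> bump_alg" for js
    using assms by (induction js) (auto simp: bump_alg_pd)
  then show ?thesis
    by (auto simp: smooth_on_def differentiable_on_def bump_alg_pd)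
qed

section \<open>Smooth approximation of indicators of boxes\<close>

lemma flat_one_bounds: "0 \<le> flat 1 t" "flat 1 t \<le> 1"
  by (auto simp: flat_def)

lemma flat_one_scale_tendsto:
  "(\<lambda>n. flat 1 (real (Suc n) * t)) \<longlonglongrightarrow> (if t > 0 then 1 else 0)"
proof (cases "t > 0")
  case True
  have "(\<lambda>n. exp (- (inverse (real (Suc n)) * (1 / t)))) \<longlonglongrightarrow> exp (- (0 * (1 / t)))"
    by (intro tendsto_intros LIMSEQ_inverse_real_of_nat)
  moreover have "flat 1 (real (Suc n) * t) = exp (- (inverse (real (Suc n)) * (1 / t)))" for n
    using True by (simp add: flat_def divide_simps)
  ultimately show ?thesis using True by simp
next
  case False
  then have "flat 1 (real (Suc n) * t) = 0" for n
    by (simp add: flat_def zero_less_mult_iff)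
  then show ?thesis using False by simp
qed

text \<open>Positive exactly on the open box, with edges that steepen as \<open>n\<close> grows, so
  the pointwise limit is the indicator of the box. \<open>Suc n\<close> keeps the scale positive at
  \<open>n = 0\<close>.\<close>

definition box_bump :: "real^'d \<Rightarrow> real^'d \<Rightarrow> nat \<Rightarrow> real^'d \<Rightarrow> real" where
  "box_bump a b n x =
    (\<Prod>j\<in>UNIV. flat 1 (real (Suc n) * (x $ j - a $ j)) * flat 1 (- real (Suc n) * (x $ j - b $ j)))"

lemma bump_alg_prod:
  "finite I \<Longrightarrow> (\<And>i. i \<in> I \<Longrightarrow> h i \<in> bump_alg) \<Longrightarrow> (\<lambda>x. \<Prod>i\<in>I. h i x) \<in> bump_alg"
  by (induction I rule: finite_induct) (auto intro: bump_alg.intros)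

lemma box_bump_in_bump_alg: "box_bump a b n \<in> bump_alg"
  unfolding box_bump_def[abs_def] by (intro bump_alg_prod bump_alg.intros) auto

lemma box_bump_bounds: "0 \<le> box_bump a b n x" "box_bump a b n x \<le> 1"
  unfolding box_bump_def
  by (auto intro!: prod_nonneg prod_le_1 mult_nonneg_nonneg mult_le_one flat_one_bounds)

lemma box_bump_eq_0:
  assumes "x \<notin> box a b" shows "box_bump a b n x = 0"
proof -
  obtain j where "x $ j \<le> a $ j \<or> b $ j \<le> x $ j"
    using assms by (auto simp: mem_box_cart not_less)
  then have "flat 1 (real (Suc n) * (x $ j - a $ j)) * flat 1 (- real (Suc n) * (x $ j - b $ j)) = 0"
    by (auto simp: flat_def zero_less_mult_iff mult_less_0_iff)
  then show ?thesis unfolding box_bump_def by (meson UNIV_I finite prod_zero)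
qed

lemma box_bump_test_fun:
  assumes "cbox a b \<subseteq> \<Omega>" shows "box_bump a b n \<in> test_fun \<Omega>"
proof -
  have "{x. box_bump a b n x \<noteq> 0} \<subseteq> box a b"
    using box_bump_eq_0[of _ a b n] by auto
  then have "closure {x. box_bump a b n x \<noteq> 0} \<subseteq> cbox a b"
    using box_subset_cbox by (intro closure_minimal) auto
  moreover have "bounded {x. box_bump a b n x \<noteq> 0}"
    using \<open>{x. box_bump a b n x \<noteq> 0} \<subseteq> box a b\<close> bounded_subset[OF bounded_box] by blast
  ultimately show ?thesis
    using assms smooth_on_bump_alg[OF box_bump_in_bump_alg] by (auto simp: test_fun_def)
qed

lemma box_bump_tendsto: "(\<lambda>n. box_bump a b n x) \<longlonglongrightarrow> indicator (box a b) x"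
proof -
  have "(\<lambda>n. box_bump a b n x) \<longlonglongrightarrow>
     (\<Prod>j\<in>UNIV. (if x $ j - a $ j > 0 then 1 else 0) * (if b $ j - x $ j > 0 then 1 else 0))"
    unfolding box_bump_def
    using flat_one_scale_tendsto[of "b $ _ - x $ _"]
    by (intro tendsto_prod tendsto_mult flat_one_scale_tendsto) (simp add: algebra_simps)
  moreover have "(\<Prod>j\<in>UNIV. (if x $ j - a $ j > 0 then 1 else 0) * (if b $ j - x $ j > 0 then 1 else 0))
     = (indicator (box a b) x :: real)"
    by (auto simp: indicator_def mem_box_cart prod_zero_iff)
  ultimately show ?thesis by simp
qed

lemma borel_measurable_lebesgue_on_continuous:
  fixes f :: "real^'d \<Rightarrow> real"
  assumes "continuous_on UNIV f" shows "f \<in> borel_measurable (lebesgue_on S)"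
  using borel_measurable_continuous_onI[OF assms]
  by (intro measurable_restrict_space1 measurable_completion) simp

lemma bump_alg_continuous:
  assumes "f \<in> bump_alg" shows "continuous_on UNIV f"
  using bump_alg_pd[OF assms] by (simp add: continuous_on_eq_continuous_at differentiable_imp_continuous_within)

text \<open>Dominated convergence along the box bumps: they lie in [0,1], which makes \<bar>g\<bar>
  a majorant, and they are test functions because the closed box lies in the domain.\<close>

lemma fundamental_lemma_box:
  fixes g :: "real^'d \<Rightarrow> real"
  assumes g: "integrable (lebesgue_on \<Omega>) g"
    and z: "\<And>\<phi>. \<phi> \<in> test_fun \<Omega> \<Longrightarrow> (LINT x|lebesgue_on \<Omega>. g x * \<phi> x) = 0"
    and ab: "cbox a b \<subseteq> \<Omega>"
  shows "(LINT x|lebesgue_on \<Omega>. g x * indicator (box a b) x) = 0"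
proof -
  have "(\<lambda>n. LINT x|lebesgue_on \<Omega>. g x * box_bump a b n x) \<longlonglongrightarrow>
      (LINT x|lebesgue_on \<Omega>. g x * indicator (box a b) x)"
  proof (rule integral_dominated_convergence[where w = "\<lambda>x. \<bar>g x\<bar>"])
    have gm: "g \<in> borel_measurable (lebesgue_on \<Omega>)" using g by simp
    show "(\<lambda>x. g x * box_bump a b n x) \<in> borel_measurable (lebesgue_on \<Omega>)" for n
      using gm borel_measurable_lebesgue_on_continuous[OF bump_alg_continuous[OF box_bump_in_bump_alg]]
      by (rule borel_measurable_times)
    have "(\<lambda>x. indicator (box a b) x :: real) \<in> borel_measurable (lebesgue_on \<Omega>)"
      by (intro measurable_restrict_space1 borel_measurable_indicator) simp
    with gm show "(\<lambda>x. g x * indicator (box a b) x) \<in> borel_measurable (lebesgue_on \<Omega>)"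
      by (rule borel_measurable_times)
    show "integrable (lebesgue_on \<Omega>) (\<lambda>x. \<bar>g x\<bar>)" using g by simp
    show "AE x in lebesgue_on \<Omega>. (\<lambda>n. g x * box_bump a b n x) \<longlonglongrightarrow> g x * indicator (box a b) x"
      by (intro AE_I2 tendsto_intros box_bump_tendsto)
    show "AE x in lebesgue_on \<Omega>. norm (g x * box_bump a b n x) \<le> \<bar>g x\<bar>" for n
      using box_bump_bounds[of a b n] by (intro AE_I2) (auto simp: abs_mult intro: mult_left_le)
  qed
  then show ?thesis
    by (simp add: z[OF box_bump_test_fun[OF ab]] LIMSEQ_const_iff)
qed

text \<open>The box integrals of \<open>g\<close> vanish, hence so does \<open>g\<close> by Lebesgue differentiation.\<close>

lemma fundamental_lemma:
  fixes g :: "real^'d \<Rightarrow> real"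
  assumes \<Omega>: "open \<Omega>" and g: "integrable (lebesgue_on \<Omega>) g"
    and z: "\<And>\<phi>. \<phi> \<in> test_fun \<Omega> \<Longrightarrow> (LINT x|lebesgue_on \<Omega>. g x * \<phi> x) = 0"
  shows "AE x in lebesgue_on \<Omega>. g x = 0"
proof -
  have \<Omega>m: "\<Omega> \<in> sets lebesgue" using \<Omega> by simp
  \<comment> \<open>Extension by zero, so that the differentiation theorem on the whole space
    applies.\<close>
  define F where "F x = g x * indicator \<Omega> x" for x
  have F: "integrable lebesgue F"
    using g \<Omega>m by (simp add: F_def[abs_def] integrable_restrict_space mult.commute)
  have Fbox: "set_integrable lebesgue S F" if "S \<in> sets lebesgue" for S
    using integrable_mult_indicator[OF that F] by (simp add: set_integrable_def)
  have "F integrable_on cbox a b" for a b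
    by (rule set_lebesgue_integral_eq_integral(1)[OF Fbox]) simp
  \<comment> \<open>Lebesgue differentiation over cubes having \<open>x\<close> as their lower
    corner.\<close>
  then obtain N where N: "negligible N"
    and lim: "\<And>x e. x \<notin> N \<Longrightarrow> 0 < e \<Longrightarrow> \<exists>d>0. \<forall>h. 0 < h \<and> h < d \<longrightarrow>
       norm (integral (cbox x (x + h *\<^sub>R One)) F /\<^sub>R h ^ DIM(real^'d) - F x) < e"
    using integrable_ccontinuous_explicit by blast
  have int0: "integral (cbox a b) F = 0" if "cbox a b \<subseteq> \<Omega>" for a b
  proof -
    have "integral (cbox a b) F = integral (box a b) F"
      by (simp add: integral_open_interval)
    also have "\<dots> = (LINT x:box a b|lebesgue. F x)"
      by (rule set_lebesgue_integral_eq_integral(2)[OF Fbox, symmetric]) simp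
    also have "\<dots> = (LINT x|lebesgue_on \<Omega>. g x * indicator (box a b) x)"
      unfolding set_lebesgue_integral_def using \<Omega>m
      by (simp add: F_def[abs_def] integral_restrict_space mult_ac)
    also have "\<dots> = 0"
      by (rule fundamental_lemma_box[OF g z that])
    finally show ?thesis .
  qed
  have "g x = 0" if x: "x \<in> \<Omega>" "x \<notin> N" for x
  proof (rule ccontr)
    assume "g x \<noteq> 0"
    then obtain d where d: "d > 0" "\<And>h. 0 < h \<Longrightarrow> h < d \<Longrightarrow>
       norm (integral (cbox x (x + h *\<^sub>R One)) F /\<^sub>R h ^ DIM(real^'d) - F x) < \<bar>g x\<bar>"
      using lim[of x "\<bar>g x\<bar>"] x by auto
    obtain r where r: "r > 0" "cball x r \<subseteq> \<Omega>"
      using \<Omega> x open_contains_cball by blast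
    \<comment> \<open>The first bound puts \<open>h\<close> below \<open>d\<close>; the second keeps
      the cube of side \<open>h\<close> inside the ball of radius \<open>r\<close>, since its
      diameter is \<open>h * norm One\<close>. The summand 1 makes the denominator visibly
      positive.\<close>
    define h where "h = min (d / 2) (r / (norm (One :: real^'d) + 1))"
    have pos: "norm (One :: real^'d) + 1 > 0"
      by (simp add: add_nonneg_pos)
    have h: "0 < h" "h < d" 
      using d r pos by (auto simp: h_def min_less_iff_disj)
    have "h * (norm (One :: real^'d) + 1) \<le> r"
      using pos by (simp add: h_def pos_le_divide_eq[symmetric])
    then have hr: "h * norm (One :: real^'d) \<le> r"
      using h by (simp add: algebra_simps)
    have "cbox x (x + h *\<^sub>R One) \<subseteq> cball x r"
    proof
      fix z assume "z \<in> cbox x (x + h *\<^sub>R One)"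
      then have "norm (z - x) \<le> norm (h *\<^sub>R (One :: real^'d))"
        by (intro norm_le_componentwise) (auto simp: mem_box algebra_simps)
      then show "z \<in> cball x r"
        using hr h by (simp add: dist_norm norm_minus_commute)
    qed
    with r int0 have "integral (cbox x (x + h *\<^sub>R One)) F = 0" by blast
    with d(2)[OF h] x show False by (simp add: F_def)
  qed
  moreover have "AE x in lebesgue_on \<Omega>. x \<notin> N"
    using N \<Omega>m by (auto simp: AE_restrict_space_iff negligible_iff_null_sets intro: AE_mp[OF AE_not_in])
  ultimately show ?thesis
    using \<Omega>m by (auto simp: AE_restrict_space_iff)
qed

section \<open>Linearity of weak derivatives\<close>

lemma finite_measure_lebesgue_on_bounded:
  fixes \<Omega> :: "(real^'d) set"
  assumes "open \<Omega>" "bounded \<Omega>" shows "finite_measure (lebesgue_on \<Omega>)"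
proof -
  have "\<Omega> \<in> lmeasurable" using assms by (simp add: lmeasurable_open)
  then show ?thesis
    by (auto intro!: finite_measureI
        simp: space_restrict_space emeasure_restrict_space fmeasurable_def
        simp del: emeasure_completion)
qed

section \<open>Inner product calculus for square-integrable functions\<close>

lemma L2D:
  assumes "f \<in> L2 \<Omega>"
  shows "f \<in> borel_measurable (lebesgue_on \<Omega>)" "integrable (lebesgue_on \<Omega>) (\<lambda>x. (norm (f x))\<^sup>2)"
  using assms by (auto simp: L2_def)

lemma L2_inner_integrable:
  assumes "f \<in> L2 \<Omega>" "g \<in> L2 \<Omega>" shows "integrable (lebesgue_on \<Omega>) (\<lambda>x. f x \<bullet> g x)"
proof (rule Bochner_Integration.integrable_bound)
  show "integrable (lebesgue_on \<Omega>) (\<lambda>x. (norm (f x))\<^sup>2 + (norm (g x))\<^sup>2)"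
    using assms by (simp add: L2_def)
  show "(\<lambda>x. f x \<bullet> g x) \<in> borel_measurable (lebesgue_on \<Omega>)"
    using assms by (auto dest!: L2D(1))
  have "\<bar>u \<bullet> v\<bar> \<le> (norm u)\<^sup>2 + (norm v)\<^sup>2" for u v :: 'b
  proof -
    have "\<bar>u \<bullet> v\<bar> \<le> norm u * norm v" by (rule Cauchy_Schwarz_ineq2)
    also have "\<dots> \<le> (norm u)\<^sup>2 + (norm v)\<^sup>2"
      using sum_squares_bound[of "norm u" "norm v"] mult_nonneg_nonneg[OF norm_ge_zero[of u] norm_ge_zero[of v]]
      by linarith
    finally show ?thesis .
  qed
  then show "AE x in lebesgue_on \<Omega>. norm (f x \<bullet> g x) \<le> norm ((norm (f x))\<^sup>2 + (norm (g x))\<^sup>2)"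
    by (intro AE_I2) simp
qed

text \<open>Expanding the square leaves only the cross term, which is integrable by
  \<open>L2_inner_integrable\<close>.\<close>

lemma L2_lincomb:
  assumes "f \<in> L2 \<Omega>" "g \<in> L2 \<Omega>" shows "(\<lambda>x. a *\<^sub>R f x + b *\<^sub>R g x) \<in> L2 \<Omega>"
proof -
  have "integrable (lebesgue_on \<Omega>)
      (\<lambda>x. a\<^sup>2 * (norm (f x))\<^sup>2 + 2 * a * b * (f x \<bullet> g x) + b\<^sup>2 * (norm (g x))\<^sup>2)"
    using assms L2_inner_integrable[OF assms] by (auto dest!: L2D(2))
  moreover have "(norm (a *\<^sub>R f x + b *\<^sub>R g x))\<^sup>2 =
      a\<^sup>2 * (norm (f x))\<^sup>2 + 2 * a * b * (f x \<bullet> g x) + b\<^sup>2 * (norm (g x))\<^sup>2" for x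
    unfolding power2_norm_eq_inner
    by (simp add: inner_left_distrib inner_right_distrib inner_commute[of "g x" "f x"]
        power2_eq_square algebra_simps)
  ultimately show ?thesis
    using assms by (auto simp: L2_def)
qed

lemma L2_scaleR_const:
  assumes "f \<in> L2 \<Omega>" shows "(\<lambda>x. f x *\<^sub>R c) \<in> L2 \<Omega>"
  using assms by (auto simp: L2_def power_mult_distrib)

lemma L2_sum:
  "finite I \<Longrightarrow> (\<And>i. i \<in> I \<Longrightarrow> f i \<in> L2 \<Omega>) \<Longrightarrow> (\<lambda>x. \<Sum>i\<in>I. f i x) \<in> L2 \<Omega>"
proof (induction I rule: finite_induct)
  case empty
  then show ?case by (simp add: L2_def)
next
  case (insert i I)
  then show ?case using L2_lincomb[of "f i" \<Omega> "\<lambda>x. \<Sum>i\<in>I. f i x" 1 1] by simp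
qed

lemma ip_commute: "ip \<Omega> f g = ip \<Omega> g f"
  by (simp add: ip_def inner_commute)

lemma ip_lincomb_left:
  assumes "f \<in> L2 \<Omega>" "g \<in> L2 \<Omega>" "h \<in> L2 \<Omega>"
  shows "ip \<Omega> (\<lambda>x. a *\<^sub>R f x + b *\<^sub>R g x) h = a * ip \<Omega> f h + b * ip \<Omega> g h"
  using L2_inner_integrable[OF assms(1,3)] L2_inner_integrable[OF assms(2,3)]
  by (simp add: ip_def inner_left_distrib)

lemma ip_cong_AE_left:
  assumes "f \<in> L2 \<Omega>" "g \<in> L2 \<Omega>" "h \<in> L2 \<Omega>" "AE x in lebesgue_on \<Omega>. f x = g x"
  shows "ip \<Omega> f h = ip \<Omega> g h"
  unfolding ip_def
  using assms L2_inner_integrable[OF assms(1,3)] L2_inner_integrable[OF assms(2,3)]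
  by (intro integral_cong_AE) auto

text \<open>The closure of the domain is compact, so the function is bounded on a set of finite
  measure.\<close>

lemma L2_continuous_bounded:
  fixes \<phi> :: "real^'d \<Rightarrow> real"
  assumes "open \<Omega>" "bounded \<Omega>" "continuous_on UNIV \<phi>"
  shows "\<phi> \<in> L2 \<Omega>"
proof -
  interpret finite_measure "lebesgue_on \<Omega>"
    by (rule finite_measure_lebesgue_on_bounded) fact+
  have m: "\<phi> \<in> borel_measurable (lebesgue_on \<Omega>)"
    by (rule borel_measurable_lebesgue_on_continuous) fact
  have "bounded (\<phi> ` closure \<Omega>)"
    using assms by (intro compact_imp_bounded compact_continuous_image)
      (auto intro: continuous_on_subset)
  then obtain K where K: "\<And>x. x \<in> \<Omega> \<Longrightarrow> \<bar>\<phi> x\<bar> \<le> K"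
    using closure_subset by (fastforce simp: bounded_iff)
  have "integrable (lebesgue_on \<Omega>) (\<lambda>x. (norm (\<phi> x))\<^sup>2)"
  proof (rule integrable_const_bound[of _ "K\<^sup>2"])
    show "AE x in lebesgue_on \<Omega>. norm ((norm (\<phi> x))\<^sup>2) \<le> K\<^sup>2"
      using K by (intro AE_I2) (auto simp: space_restrict_space abs_le_square_iff[symmetric] intro: order_trans[OF _ abs_ge_self])
  qed (use m in measurable)
  with m show ?thesis by (simp add: L2_def)
qed

lemma test_fun_continuous:
  assumes "\<phi> \<in> test_fun \<Omega>"
  shows "continuous_on UNIV \<phi>" "continuous_on UNIV (pd j \<phi>)"
proof -
  have "smooth_on UNIV \<phi>" using assms by (simp add: test_fun_def)
  then have "iter_pd [] \<phi> differentiable_on UNIV" "iter_pd [j] \<phi> differentiable_on UNIV"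
    unfolding smooth_on_def by blast+
  then show "continuous_on UNIV \<phi>" "continuous_on UNIV (pd j \<phi>)"
    by (simp_all add: differentiable_imp_continuous_on)
qed

section \<open>Uniqueness and linearity of weak partial derivatives\<close>

locale bounded_domain =
  fixes \<Omega> :: "(real^'d) set"
  assumes open_dom: "open \<Omega>" and bounded_dom: "bounded \<Omega>"
begin

lemma test_fun_L2: "\<phi> \<in> test_fun \<Omega> \<Longrightarrow> \<phi> \<in> L2 \<Omega>"
  and pd_test_fun_L2: "\<phi> \<in> test_fun \<Omega> \<Longrightarrow> pd j \<phi> \<in> L2 \<Omega>"
  using L2_continuous_bounded[OF open_dom bounded_dom] test_fun_continuous by blast+

lemma L2_integrable:
  fixes g :: "real^'d \<Rightarrow> real"
  assumes "g \<in> L2 \<Omega>" shows "integrable (lebesgue_on \<Omega>) g"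
  using L2_inner_integrable[OF assms L2_continuous_bounded[OF open_dom bounded_dom, of "\<lambda>_. 1"]]
  by simp

text \<open>The difference of two weak derivatives is orthogonal to every test function, so the
  fundamental lemma applies. This is what makes the choice in \<open>wpd\<close> harmless up to null
  sets.\<close>

lemma weak_pd_unique:
  assumes "g \<in> L2 \<Omega>" "g' \<in> L2 \<Omega>" "weak_pd \<Omega> j f g" "weak_pd \<Omega> j f g'"
  shows "AE x in lebesgue_on \<Omega>. g x = g' x"
proof -
  let ?h = "\<lambda>x. 1 *\<^sub>R g x + (- 1) *\<^sub>R g' x"
  have h: "?h \<in> L2 \<Omega>" using assms by (intro L2_lincomb)
  have "(LINT x|lebesgue_on \<Omega>. ?h x * \<phi> x) = 0" if "\<phi> \<in> test_fun \<Omega>" for \<phi>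
  proof -
    have "ip \<Omega> ?h \<phi> = 1 * ip \<Omega> g \<phi> + (- 1) * ip \<Omega> g' \<phi>"
      using assms test_fun_L2[OF that] by (intro ip_lincomb_left)
    also have "\<dots> = 0" using assms(3,4) that by (auto simp: weak_pd_def)
    finally show ?thesis by (simp add: ip_def)
  qed
  from fundamental_lemma[OF open_dom L2_integrable[OF h] this]
  show ?thesis by simp
qed

lemma weak_pd_lincomb:
  assumes L2: "f \<in> L2 \<Omega>" "g \<in> L2 \<Omega>" "f' \<in> L2 \<Omega>" "g' \<in> L2 \<Omega>"
    and w: "weak_pd \<Omega> j f f'" "weak_pd \<Omega> j g g'"
  shows "weak_pd \<Omega> j (\<lambda>x. a *\<^sub>R f x + b *\<^sub>R g x) (\<lambda>x. a *\<^sub>R f' x + b *\<^sub>R g' x)"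
  unfolding weak_pd_def
proof
  fix \<phi> assume \<phi>: "\<phi> \<in> test_fun \<Omega>"
  show "ip \<Omega> (\<lambda>x. a *\<^sub>R f x + b *\<^sub>R g x) (pd j \<phi>) = - ip \<Omega> (\<lambda>x. a *\<^sub>R f' x + b *\<^sub>R g' x) \<phi>"
    unfolding ip_lincomb_left[OF L2(1,2) pd_test_fun_L2[OF \<phi>]]
      ip_lincomb_left[OF L2(3,4) test_fun_L2[OF \<phi>]]
    using w \<phi> by (simp add: weak_pd_def)
qed

lemma wpd:
  assumes "f \<in> H1 \<Omega>"
  shows "wpd \<Omega> j f \<in> L2 \<Omega>" "weak_pd \<Omega> j f (wpd \<Omega> j f)"
proof -
  have "\<exists>g. g \<in> L2 \<Omega> \<and> weak_pd \<Omega> j f g" using assms by (auto simp: H1_def)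
  from someI_ex[OF this] show "wpd \<Omega> j f \<in> L2 \<Omega>" "weak_pd \<Omega> j f (wpd \<Omega> j f)"
    by (auto simp: wpd_def)
qed

lemma wpd_AE_eq:
  assumes "f \<in> H1 \<Omega>" "g \<in> L2 \<Omega>" "weak_pd \<Omega> j f g"
  shows "AE x in lebesgue_on \<Omega>. wpd \<Omega> j f x = g x"
  using weak_pd_unique[OF wpd(1)[OF assms(1)] assms(2) wpd(2)[OF assms(1)] assms(3)] .

lemma wpd_lincomb:
  assumes "f \<in> H1 \<Omega>" "g \<in> H1 \<Omega>" "(\<lambda>x. a *\<^sub>R f x + b *\<^sub>R g x) \<in> H1 \<Omega>"
  shows "AE x in lebesgue_on \<Omega>. wpd \<Omega> j (\<lambda>x. a *\<^sub>R f x + b *\<^sub>R g x) x =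
    a *\<^sub>R wpd \<Omega> j f x + b *\<^sub>R wpd \<Omega> j g x"
proof -
  have "f \<in> L2 \<Omega>" "g \<in> L2 \<Omega>" using assms by (auto simp: H1_def)
  then show ?thesis
    using assms wpd by (intro wpd_AE_eq L2_lincomb weak_pd_lincomb) auto
qed

lemma wpd_AE_zero:
  assumes "f \<in> H1 \<Omega>" "AE x in lebesgue_on \<Omega>. f x = 0"
  shows "AE x in lebesgue_on \<Omega>. wpd \<Omega> j f x = 0"
proof (rule wpd_AE_eq[OF assms(1)])
  show z: "(\<lambda>x. 0::real) \<in> L2 \<Omega>" by (simp add: L2_def)
  have f: "f \<in> L2 \<Omega>" using assms by (simp add: H1_def)
  show "weak_pd \<Omega> j f (\<lambda>x. 0)"
    using ip_cong_AE_left[OF f z pd_test_fun_L2 assms(2)] by (simp add: weak_pd_def ip_def)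
qed

section \<open>Gradient and divergence of velocity fields\<close>

lemma X_component_H1: "u \<in> X \<Omega> \<Longrightarrow> (\<lambda>x. u x $ i) \<in> H1 \<Omega>"
  by (auto simp: X_def H10_def)

lemma grad_L2:
  assumes "u \<in> X \<Omega>" shows "grad \<Omega> u \<in> L2 \<Omega>"
proof -
  \<comment> \<open>The gradient is expanded in the basis matrices, which reduces the claim to the
    scalar entries.\<close>
  have "(\<lambda>x. \<Sum>i\<in>UNIV. \<Sum>j\<in>UNIV. wpd \<Omega> j (\<lambda>z. u z $ i) x *\<^sub>R axis i (axis j (1::real))) \<in> L2 \<Omega>"
    by (intro L2_sum L2_scaleR_const wpd X_component_H1[OF assms]) auto
  moreover have "grad \<Omega> u x =
      (\<Sum>i\<in>UNIV. \<Sum>j\<in>UNIV. wpd \<Omega> j (\<lambda>z. u z $ i) x *\<^sub>R axis i (axis j (1::real)))" for x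
  proof -
    have "(\<Sum>i\<in>UNIV. \<Sum>j\<in>UNIV. (wpd \<Omega> j (\<lambda>z. u z $ i) x *\<^sub>R axis i (axis j (1::real))) $ k $ l) =
        wpd \<Omega> l (\<lambda>z. u z $ k) x" for k l
    proof -
      have "(\<Sum>i\<in>UNIV. \<Sum>j\<in>UNIV. (wpd \<Omega> j (\<lambda>z. u z $ i) x *\<^sub>R axis i (axis j (1::real))) $ k $ l) =
          (\<Sum>i\<in>UNIV. if k = i then \<Sum>j\<in>UNIV. if l = j then wpd \<Omega> j (\<lambda>z. u z $ i) x else 0 else 0)"
        by (intro sum.cong refl) (auto simp: axis_def if_distrib cong: if_cong)
      then show ?thesis by simp
    qed
    then show ?thesis by (simp add: grad_def vec_eq_iff)
  qed
  ultimately show ?thesis by presburger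
qed

text \<open>The representatives of the three gradients are chosen independently, so equality holds
  only almost everywhere. For discrete velocities, membership of the combination in
  \<open>X \<Omega>\<close> comes from the linearity of \<open>Xh\<close>.\<close>

lemma grad_lincomb:
  assumes "u \<in> X \<Omega>" "v \<in> X \<Omega>" "(\<lambda>x. a *\<^sub>R u x + b *\<^sub>R v x) \<in> X \<Omega>"
  shows "AE x in lebesgue_on \<Omega>. grad \<Omega> (\<lambda>x. a *\<^sub>R u x + b *\<^sub>R v x) x =
    a *\<^sub>R grad \<Omega> u x + b *\<^sub>R grad \<Omega> v x"
proof -
  have "AE x in lebesgue_on \<Omega>. wpd \<Omega> j (\<lambda>x. (a *\<^sub>R u x + b *\<^sub>R v x) $ i) x =
      a *\<^sub>R wpd \<Omega> j (\<lambda>x. u x $ i) x + b *\<^sub>R wpd \<Omega> j (\<lambda>x. v x $ i) x" for i j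
    using wpd_lincomb[of "\<lambda>x. u x $ i" "\<lambda>x. v x $ i" a b j] assms[THEN X_component_H1, of i] by simp
  then have "AE x in lebesgue_on \<Omega>. \<forall>i j. wpd \<Omega> j (\<lambda>x. (a *\<^sub>R u x + b *\<^sub>R v x) $ i) x =
      a *\<^sub>R wpd \<Omega> j (\<lambda>x. u x $ i) x + b *\<^sub>R wpd \<Omega> j (\<lambda>x. v x $ i) x"
    by (simp add: eventually_all_finite)
  then show ?thesis
    by (rule AE_mp) (simp add: grad_def vec_eq_iff)
qed

text \<open>Used in contrapositive form: a field with nonzero gradient norm belongs to the index set
  of the supremum in \<open>dual_norm\<close>.\<close>

lemma gnorm_AE_zero:
  assumes "v \<in> X \<Omega>" "\<not> nonzero_on \<Omega> v" shows "gnorm \<Omega> v = 0"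
proof -
  have "AE x in lebesgue_on \<Omega>. v x $ i = 0" for i
    using assms(2) by (auto simp: nonzero_on_def elim!: AE_mp)
  then have "AE x in lebesgue_on \<Omega>. wpd \<Omega> j (\<lambda>x. v x $ i) x = 0" for i j
    using assms(1) by (intro wpd_AE_zero X_component_H1)
  then have "AE x in lebesgue_on \<Omega>. \<forall>i j. wpd \<Omega> j (\<lambda>x. v x $ i) x = 0"
    by (simp add: eventually_all_finite)
  then have "AE x in lebesgue_on \<Omega>. grad \<Omega> v x = 0"
    by (rule AE_mp) (simp add: grad_def vec_eq_iff)
  then have "ip \<Omega> (grad \<Omega> v) (grad \<Omega> v) = ip \<Omega> (\<lambda>x. 0) (grad \<Omega> v)"
    using assms(1) by (intro ip_cong_AE_left grad_L2) (auto simp: L2_def)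
  then show ?thesis by (simp add: gnorm_def L2norm_def ip_def)
qed

lemma ip_grad_lincomb:
  assumes "u \<in> X \<Omega>" "v \<in> X \<Omega>" "(\<lambda>x. a *\<^sub>R u x + b *\<^sub>R v x) \<in> X \<Omega>" "w \<in> X \<Omega>"
  shows "ip \<Omega> (grad \<Omega> (\<lambda>x. a *\<^sub>R u x + b *\<^sub>R v x)) (grad \<Omega> w) =
    a * ip \<Omega> (grad \<Omega> u) (grad \<Omega> w) + b * ip \<Omega> (grad \<Omega> v) (grad \<Omega> w)"
proof -
  have "ip \<Omega> (grad \<Omega> (\<lambda>x. a *\<^sub>R u x + b *\<^sub>R v x)) (grad \<Omega> w) =
      ip \<Omega> (\<lambda>x. a *\<^sub>R grad \<Omega> u x + b *\<^sub>R grad \<Omega> v x) (grad \<Omega> w)"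
    using assms by (intro ip_cong_AE_left grad_L2 L2_lincomb grad_lincomb)
  then show ?thesis using assms by (simp add: ip_lincomb_left grad_L2)
qed

lemma divg_L2:
  assumes "u \<in> X \<Omega>" shows "divg \<Omega> u \<in> L2 \<Omega>"
proof -
  have "(\<lambda>x. \<Sum>i\<in>UNIV. wpd \<Omega> i (\<lambda>z. u z $ i) x) \<in> L2 \<Omega>"
    by (intro L2_sum wpd X_component_H1[OF assms]) auto
  moreover have "divg \<Omega> u = (\<lambda>x. \<Sum>i\<in>UNIV. wpd \<Omega> i (\<lambda>z. u z $ i) x)"
    by (auto simp: divg_def grad_def trace_def)
  ultimately show ?thesis by simp
qed

lemma ip_divg_lincomb:
  assumes "u \<in> X \<Omega>" "v \<in> X \<Omega>" "(\<lambda>x. a *\<^sub>R u x + b *\<^sub>R v x) \<in> X \<Omega>" "q \<in> L2 \<Omega>"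
  shows "ip \<Omega> (divg \<Omega> (\<lambda>x. a *\<^sub>R u x + b *\<^sub>R v x)) q = a * ip \<Omega> (divg \<Omega> u) q + b * ip \<Omega> (divg \<Omega> v) q"
proof -
  have "AE x in lebesgue_on \<Omega>. divg \<Omega> (\<lambda>x. a *\<^sub>R u x + b *\<^sub>R v x) x =
      a *\<^sub>R divg \<Omega> u x + b *\<^sub>R divg \<Omega> v x"
    using grad_lincomb[OF assms(1-3)]
    by (rule AE_mp) (simp add: divg_def trace_def sum.distrib sum_distrib_left)
  then have "ip \<Omega> (divg \<Omega> (\<lambda>x. a *\<^sub>R u x + b *\<^sub>R v x)) q =
      ip \<Omega> (\<lambda>x. a *\<^sub>R divg \<Omega> u x + b *\<^sub>R divg \<Omega> v x) q"
    using assms by (intro ip_cong_AE_left divg_L2 L2_lincomb)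
  then show ?thesis using assms by (simp only: ip_lincomb_left divg_L2)
qed

section \<open>Linearity of the trilinear form in its first two arguments\<close>

lemma ip_convect_lincomb_left:
  assumes "tri_bound \<Omega> M" "u \<in> X \<Omega>" "v \<in> X \<Omega>" "w \<in> X \<Omega>" "z \<in> X \<Omega>"
  shows "ip \<Omega> (convect \<Omega> (\<lambda>x. a *\<^sub>R u x + b *\<^sub>R v x) w) z =
    a * ip \<Omega> (convect \<Omega> u w) z + b * ip \<Omega> (convect \<Omega> v w) z"
proof -
  have "integrable (lebesgue_on \<Omega>) (\<lambda>x. convect \<Omega> u w x \<bullet> z x)"
    "integrable (lebesgue_on \<Omega>) (\<lambda>x. convect \<Omega> v w x \<bullet> z x)"
    using assms by (auto simp: tri_bound_def)
  then show ?thesis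
    by (simp add: ip_def convect_def matrix_vector_right_distrib matrix_vector_mult_scaleR
        inner_left_distrib)
qed

text \<open>The varying argument stands under the derivative, so the integrands agree only almost
  everywhere. \<open>tri_bound\<close> supplies the integrability needed to split the
  integral.\<close>

lemma ip_convect_lincomb_mid:
  assumes "tri_bound \<Omega> M" "u \<in> X \<Omega>" "v \<in> X \<Omega>" "(\<lambda>x. a *\<^sub>R u x + b *\<^sub>R v x) \<in> X \<Omega>"
    "w \<in> X \<Omega>" "z \<in> X \<Omega>"
  shows "ip \<Omega> (convect \<Omega> w (\<lambda>x. a *\<^sub>R u x + b *\<^sub>R v x)) z =
    a * ip \<Omega> (convect \<Omega> w u) z + b * ip \<Omega> (convect \<Omega> w v) z"
proof -
  let ?s = "\<lambda>x. a *\<^sub>R u x + b *\<^sub>R v x"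
  have i: "integrable (lebesgue_on \<Omega>) (\<lambda>x. convect \<Omega> w u x \<bullet> z x)"
    "integrable (lebesgue_on \<Omega>) (\<lambda>x. convect \<Omega> w v x \<bullet> z x)"
    "integrable (lebesgue_on \<Omega>) (\<lambda>x. convect \<Omega> w ?s x \<bullet> z x)"
    using assms by (auto simp: tri_bound_def)
  have "AE x in lebesgue_on \<Omega>. convect \<Omega> w ?s x \<bullet> z x =
      a * (convect \<Omega> w u x \<bullet> z x) + b * (convect \<Omega> w v x \<bullet> z x)"
    using grad_lincomb[OF assms(2-4)]
    by (rule AE_mp) (simp add: convect_def matrix_vector_mult_add_rdistrib
        scaleR_matrix_vector_assoc[symmetric] inner_left_distrib)
  then have "ip \<Omega> (convect \<Omega> w ?s) z =
      (LINT x|lebesgue_on \<Omega>. a * (convect \<Omega> w u x \<bullet> z x) + b * (convect \<Omega> w v x \<bullet> z x))"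
    unfolding ip_def using i by (intro integral_cong_AE) auto
  then show ?thesis using i by (simp add: ip_def)
qed

lemma ip_convect_lincomb_right:
  assumes "tri_bound \<Omega> M" "u \<in> X \<Omega>" "v \<in> X \<Omega>" "w \<in> X \<Omega>" "z \<in> X \<Omega>"
  shows "ip \<Omega> (convect \<Omega> w z) (\<lambda>x. a *\<^sub>R u x + b *\<^sub>R v x) =
    a * ip \<Omega> (convect \<Omega> w z) u + b * ip \<Omega> (convect \<Omega> w z) v"
proof -
  have "integrable (lebesgue_on \<Omega>) (\<lambda>x. convect \<Omega> w z x \<bullet> u x)"
    "integrable (lebesgue_on \<Omega>) (\<lambda>x. convect \<Omega> w z x \<bullet> v x)"
    using assms by (auto simp: tri_bound_def)
  then show ?thesis by (simp add: ip_def inner_right_distrib)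
qed

text \<open>Skew-symmetrisation puts the second argument once under the derivative and once in the
  inner product; linearity in it combines the middle and right versions above.\<close>

lemma tri_lincomb:
  assumes "tri_bound \<Omega> M" "u \<in> X \<Omega>" "v \<in> X \<Omega>" "(\<lambda>x. a *\<^sub>R u x + b *\<^sub>R v x) \<in> X \<Omega>"
    "w \<in> X \<Omega>" "z \<in> X \<Omega>"
  shows "tri \<Omega> (\<lambda>x. a *\<^sub>R u x + b *\<^sub>R v x) w z = a * tri \<Omega> u w z + b * tri \<Omega> v w z"
    and "tri \<Omega> w (\<lambda>x. a *\<^sub>R u x + b *\<^sub>R v x) z = a * tri \<Omega> w u z + b * tri \<Omega> w v z"
  unfolding tri_def
  using assms by (simp_all add: ip_convect_lincomb_left ip_convect_lincomb_mid
      ip_convect_lincomb_right algebra_simps)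

end

lemma tri_antisym: "tri \<Omega> u v w = - tri \<Omega> u w v"
  by (simp add: tri_def field_simps)

lemma fin_dim_space_lincomb:
  assumes "fin_dim_space S" "u \<in> S" "v \<in> S" shows "(\<lambda>x. a *\<^sub>R u x + b *\<^sub>R v x) \<in> S"
proof -
  obtain B c d where S: "S = {\<lambda>x. \<Sum>b\<in>B. c b *\<^sub>R b x | c. True}"
    and "u = (\<lambda>x. \<Sum>b\<in>B. c b *\<^sub>R b x)" "v = (\<lambda>x. \<Sum>b\<in>B. d b *\<^sub>R b x)"
    using assms by (auto simp: fin_dim_space_def)
  then have "(\<lambda>x. a *\<^sub>R u x + b *\<^sub>R v x) = (\<lambda>x. \<Sum>e\<in>B. (a * c e + b * d e) *\<^sub>R e x)"
    by (auto simp: scaleR_sum_right sum.distrib[symmetric] scaleR_add_left intro!: sum.cong)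
  then show ?thesis unfolding S by (intro CollectI exI[of _ "\<lambda>e. a * c e + b * d e"]) simp
qed

section \<open>Mixing of Newton steps for a quadratic equation\<close>

text \<open>The algebra of the convergence argument, free of integrals. \<open>D\<close> is only
  nonnegative on the diagonal, not definite, because a nonzero function may represent the zero
  vector.\<close>

locale newton_forms =
  fixes V :: "('a \<Rightarrow> 'b::real_vector) set"
    and B :: "('a \<Rightarrow> 'b) \<Rightarrow> ('a \<Rightarrow> 'b) \<Rightarrow> ('a \<Rightarrow> 'b) \<Rightarrow> real"
    and D :: "('a \<Rightarrow> 'b) \<Rightarrow> ('a \<Rightarrow> 'b) \<Rightarrow> real"
    and f :: "('a \<Rightarrow> 'b) \<Rightarrow> real"
    and M \<nu> R :: real
  assumes V_zero: "(\<lambda>x. 0) \<in> V"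
    and V_lincomb: "u \<in> V \<Longrightarrow> v \<in> V \<Longrightarrow> (\<lambda>x. a *\<^sub>R u x + b *\<^sub>R v x) \<in> V"
    and B_lincomb1: "u \<in> V \<Longrightarrow> v \<in> V \<Longrightarrow> w \<in> V \<Longrightarrow> z \<in> V \<Longrightarrow>
      B (\<lambda>x. a *\<^sub>R u x + b *\<^sub>R v x) w z = a * B u w z + b * B v w z"
    and B_lincomb2: "u \<in> V \<Longrightarrow> v \<in> V \<Longrightarrow> w \<in> V \<Longrightarrow> z \<in> V \<Longrightarrow>
      B w (\<lambda>x. a *\<^sub>R u x + b *\<^sub>R v x) z = a * B w u z + b * B w v z"
    and B_antisym: "B u v w = - B u w v"
    and D_lincomb: "u \<in> V \<Longrightarrow> v \<in> V \<Longrightarrow> w \<in> V \<Longrightarrow>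
      D (\<lambda>x. a *\<^sub>R u x + b *\<^sub>R v x) w = a * D u w + b * D v w"
    and D_commute: "D u v = D v u"
    and D_nonneg: "0 \<le> D u u"
    and B_bound: "u \<in> V \<Longrightarrow> v \<in> V \<Longrightarrow> w \<in> V \<Longrightarrow>
      B u v w \<le> M * sqrt (D u u) * sqrt (D v v) * sqrt (D w w)"
    and M_pos: "0 < M" and \<nu>_pos: "0 < \<nu>" and R_less: "R < \<nu> / M"
begin

section \<open>Energy seminorm, Cauchy-Schwarz and finite combinations\<close>

definition en :: "('a \<Rightarrow> 'b) \<Rightarrow> real" where
  "en u = sqrt (D u u)"

lemma en_nonneg [simp]: "0 \<le> en u"
  by (simp add: en_def D_nonneg)

lemma en_sq: "en u * en u = D u u"
  by (simp add: en_def D_nonneg)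

lemma V_diff: "u \<in> V \<Longrightarrow> v \<in> V \<Longrightarrow> (\<lambda>x. u x - v x) \<in> V"
  using V_lincomb[of u v 1 "-1"] by simp

lemma B_diff1:
  "u \<in> V \<Longrightarrow> v \<in> V \<Longrightarrow> w \<in> V \<Longrightarrow> z \<in> V \<Longrightarrow> B (\<lambda>x. u x - v x) w z = B u w z - B v w z"
  using B_lincomb1[of u v w z 1 "-1"] by simp

lemma B_diff2:
  "u \<in> V \<Longrightarrow> v \<in> V \<Longrightarrow> w \<in> V \<Longrightarrow> z \<in> V \<Longrightarrow> B w (\<lambda>x. u x - v x) z = B w u z - B w v z"
  using B_lincomb2[of u v w z 1 "-1"] by simp

lemma D_diff: "u \<in> V \<Longrightarrow> v \<in> V \<Longrightarrow> w \<in> V \<Longrightarrow> D (\<lambda>x. u x - v x) w = D u w - D v w"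
  using D_lincomb[of u v w 1 "-1"] by simp

lemma B_diag: "B u v v = 0"
  using B_antisym[of u v v] by simp

lemma D_lincomb_sq:
  assumes "u \<in> V" "v \<in> V"
  shows "D (\<lambda>x. a *\<^sub>R u x + b *\<^sub>R v x) (\<lambda>x. a *\<^sub>R u x + b *\<^sub>R v x) =
    a\<^sup>2 * D u u + 2 * a * b * D u v + b\<^sup>2 * D v v"
proof -
  let ?s = "\<lambda>x. a *\<^sub>R u x + b *\<^sub>R v x"
  have "D ?s ?s = a * D u ?s + b * D v ?s"
    using assms by (intro D_lincomb V_lincomb)
  moreover have "D u ?s = a * D u u + b * D u v"
    using D_lincomb[OF assms assms(1), of a b] by (simp add: D_commute[of u ?s] D_commute[of v u])
  moreover have "D v ?s = a * D u v + b * D v v"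
    using D_lincomb[OF assms assms(2), of a b] by (simp add: D_commute[of v ?s])
  ultimately show ?thesis
    by (simp add: power2_eq_square algebra_simps)
qed

text \<open>Cauchy-Schwarz for a semi-inner product, from nonnegativity of the quadratic form in
  \<open>a\<close> and \<open>b\<close>.\<close>

lemma D_bound:
  assumes "u \<in> V" "v \<in> V" shows "\<bar>D u v\<bar> \<le> en u * en v"
proof -
  have *: "0 \<le> a\<^sup>2 * D u u + 2 * a * b * D u v + b\<^sup>2 * D v v" for a b
    using D_nonneg D_lincomb_sq[OF assms] by metis
  have "(D u v)\<^sup>2 \<le> D u u * D v v"
  proof (cases "D v v = 0")
    case True
    have "D u v = 0"
    proof (rule ccontr)
      assume "D u v \<noteq> 0"
      \<comment> \<open>With \<open>D v v = 0\<close> this choice makes the quadratic form equal to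
        -1.\<close>
      then show False using *[of 1 "- (D u u + 1) / (2 * D u v)"] D_nonneg[of u] True
        by (simp add: field_simps)
    qed
    then show ?thesis by (simp add: True)
  next
    case False
    then have "0 < D v v" using D_nonneg[of v] by linarith
    \<comment> \<open>These coefficients minimise the form up to scaling and leave the discriminant
      times \<open>D v v\<close>.\<close>
    moreover have "0 \<le> D v v * (D v v * D u u - (D u v)\<^sup>2)"
      using *[of "D v v" "- D u v"] by (simp add: power2_eq_square algebra_simps)
    ultimately show ?thesis by (simp add: zero_le_mult_iff mult.commute)
  qed
  then have "sqrt ((D u v)\<^sup>2) \<le> sqrt (D u u * D v v)" by (rule real_sqrt_le_mono)
  then show ?thesis by (simp add: en_def real_sqrt_mult)
qed

lemma en_lincomb:
  assumes "u \<in> V" "v \<in> V"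
  shows "en (\<lambda>x. a *\<^sub>R u x + b *\<^sub>R v x) \<le> \<bar>a\<bar> * en u + \<bar>b\<bar> * en v"
proof -
  have "\<bar>2 * a * b * D u v\<bar> \<le> \<bar>2 * a * b\<bar> * (en u * en v)"
    unfolding abs_mult[of "2 * a * b"] by (intro mult_left_mono D_bound assms) simp
  then have "2 * a * b * D u v \<le> \<bar>2 * a * b\<bar> * (en u * en v)" by linarith
  then have "D (\<lambda>x. a *\<^sub>R u x + b *\<^sub>R v x) (\<lambda>x. a *\<^sub>R u x + b *\<^sub>R v x) \<le> (\<bar>a\<bar> * en u + \<bar>b\<bar> * en v)\<^sup>2"
    unfolding D_lincomb_sq[OF assms] en_sq[symmetric]
    by (simp add: power2_eq_square abs_mult algebra_simps)
  then show ?thesis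
    unfolding en_def[of "\<lambda>x. a *\<^sub>R u x + b *\<^sub>R v x"] by (intro real_le_lsqrt) auto
qed

lemma en_diff_le: "u \<in> V \<Longrightarrow> v \<in> V \<Longrightarrow> en (\<lambda>x. u x - v x) \<le> en u + en v"
  using en_lincomb[of u v 1 "-1"] by simp

text \<open>Antisymmetry rewrites the negative of the form as the form with its last two arguments
  exchanged, so the one-sided bound controls both signs.\<close>

lemma B_abs_bound:
  assumes "u \<in> V" "v \<in> V" "w \<in> V" shows "\<bar>B u v w\<bar> \<le> M * en u * en v * en w"
  using B_bound[of u v w] B_bound[of u w v] B_antisym[of u v w] assms
  unfolding en_def by (simp add: abs_le_iff mult_ac)

text \<open>The five claims are proved by one induction because the later ones need the tail sum to
  lie in \<open>V\<close>.\<close>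

lemma
  assumes "finite I" "\<And>i. i \<in> I \<Longrightarrow> w i \<in> V"
  shows V_sum: "(\<lambda>x. \<Sum>i\<in>I. c i *\<^sub>R w i x) \<in> V"
    and B_sum1: "u \<in> V \<Longrightarrow> v \<in> V \<Longrightarrow> B (\<lambda>x. \<Sum>i\<in>I. c i *\<^sub>R w i x) u v = (\<Sum>i\<in>I. c i * B (w i) u v)"
    and B_sum2: "u \<in> V \<Longrightarrow> v \<in> V \<Longrightarrow> B u (\<lambda>x. \<Sum>i\<in>I. c i *\<^sub>R w i x) v = (\<Sum>i\<in>I. c i * B u (w i) v)"
    and D_sum: "v \<in> V \<Longrightarrow> D (\<lambda>x. \<Sum>i\<in>I. c i *\<^sub>R w i x) v = (\<Sum>i\<in>I. c i * D (w i) v)"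
    and en_sum: "en (\<lambda>x. \<Sum>i\<in>I. c i *\<^sub>R w i x) \<le> (\<Sum>i\<in>I. \<bar>c i\<bar> * en (w i))"
  using assms
proof (induction I rule: finite_induct)
  case empty
  {
    case 1 show ?case using V_zero by simp
  next
    case 2 then show ?case using B_lincomb1[of u u u v 0 0] by simp
  next
    case 3 then show ?case using B_lincomb2[of u u u v 0 0] by simp
  next
    case 4 then show ?case using D_lincomb[of v v v 0 0] by simp
  next
    case 5 show ?case using en_lincomb[OF V_zero V_zero, of 0 0] by simp
  }
next
  case (insert j I)
  let ?s = "\<lambda>x. \<Sum>i\<in>I. c i *\<^sub>R w i x"
  have w: "w j \<in> V" if "\<And>i. i \<in> insert j I \<Longrightarrow> w i \<in> V" using that by simp
  have e: "(\<lambda>x. \<Sum>i\<in>insert j I. c i *\<^sub>R w i x) = (\<lambda>x. c j *\<^sub>R w j x + 1 *\<^sub>R ?s x)"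
    using insert.hyps by simp
  {
    case 1
    then show ?case unfolding e using insert.IH(1) by (intro V_lincomb) auto
  next
    case 2
    then show ?case unfolding e using insert by (subst B_lincomb1) auto
  next
    case 3
    then show ?case unfolding e using insert by (subst B_lincomb2) auto
  next
    case 4
    then show ?case unfolding e using insert by (subst D_lincomb) auto
  next
    case 5
    then have "?s \<in> V" "en ?s \<le> (\<Sum>i\<in>I. \<bar>c i\<bar> * en (w i))" using insert.IH by auto
    with 5 show ?case unfolding e
      using en_lincomb[of "w j" ?s "c j" 1] insert.hyps by fastforce
  }
qed

section \<open>Residuals and updates of Newton steps on the ball\<close>

definition res :: "('a \<Rightarrow> 'b) \<Rightarrow> ('a \<Rightarrow> 'b) \<Rightarrow> real" where
  "res u v = f v - B u u v - \<nu> * D u v"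

definition newton :: "('a \<Rightarrow> 'b) \<Rightarrow> ('a \<Rightarrow> 'b) \<Rightarrow> bool" where
  "newton u w \<longleftrightarrow> u \<in> V \<and> en u \<le> R \<and> w \<in> V \<and>
    (\<forall>v\<in>V. B u w v + B w u v - B u u v + \<nu> * D w v = f v)"

text \<open>Coercivity constant of the linearised operator at points of the ball: viscosity minus
  the largest possible effect of convection.\<close>

definition \<kappa> :: real where "\<kappa> = \<nu> - M * R"

lemma \<kappa>_pos: "0 < \<kappa>"
  using R_less M_pos by (simp add: \<kappa>_def field_simps)

lemma MR_le: "M * R \<le> \<nu>"
  using \<kappa>_pos by (simp add: \<kappa>_def)

lemma newtonD:
  assumes "newton u w"
  shows "u \<in> V" "w \<in> V" "(\<lambda>x. w x - u x) \<in> V" "en u \<le> R"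
    "v \<in> V \<Longrightarrow> B u w v + B w u v - B u u v + \<nu> * D w v = f v"
  using assms V_diff by (auto simp: newton_def)

lemma B_ball_bound:
  assumes "u \<in> V" "en u \<le> R" "v \<in> V" "w \<in> V"
  shows "\<bar>B u v w\<bar> \<le> M * R * en v * en w" "\<bar>B v u w\<bar> \<le> M * R * en v * en w"
proof -
  have "\<bar>B u v w\<bar> \<le> M * en u * en v * en w" using assms by (intro B_abs_bound)
  also have "\<dots> \<le> M * R * en v * en w"
    using assms M_pos by (intro mult_right_mono mult_left_mono) auto
  finally show "\<bar>B u v w\<bar> \<le> M * R * en v * en w" .
  have "\<bar>B v u w\<bar> \<le> M * en v * en u * en w" using assms by (intro B_abs_bound)
  also have "\<dots> = M * en u * en v * en w" by simp
  also have "\<dots> \<le> M * R * en v * en w"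
    using assms M_pos by (intro mult_right_mono mult_left_mono) auto
  finally show "\<bar>B v u w\<bar> \<le> M * R * en v * en w" .
qed

text \<open>The Newton equation rewritten, with \<open>w = u + y\<close>, as a linear equation for
  the update.\<close>

lemma res_eq_update:
  assumes "newton u w" "v \<in> V"
  defines "y \<equiv> \<lambda>x. w x - u x"
  shows "res u v = B u y v + B y u v + \<nu> * D y v"
  using newtonD[OF assms(1)] newtonD(5)[OF assms(1,2)] assms(2)
  unfolding y_def by (simp add: B_diff1 B_diff2 D_diff res_def algebra_simps)

text \<open>The Newton equation holds the affine part of B(w,w) about \<open>u\<close>; what remains
  is the pure second-order term.\<close>

lemma res_newton:
  assumes "newton u w" "v \<in> V"
  defines "y \<equiv> \<lambda>x. w x - u x"
  shows "res w v = - B y y v"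
  using newtonD[OF assms(1)] newtonD(5)[OF assms(1,2)] assms(2)
  unfolding y_def by (simp add: B_diff1 B_diff2 V_diff res_def algebra_simps)

text \<open>The factor 3 counts two convective terms, each at most \<nu> because
  \<open>M * R \<le> \<nu>\<close>, and one viscous term.\<close>

lemma res_bound:
  assumes "newton u w" "v \<in> V"
  shows "\<bar>res u v\<bar> \<le> 3 * \<nu> * en (\<lambda>x. w x - u x) * en v"
proof -
  let ?y = "\<lambda>x. w x - u x"
  note n = newtonD[OF assms(1)]
  have "M * R * en ?y * en v \<le> \<nu> * en ?y * en v"
    using MR_le by (intro mult_right_mono) auto
  moreover have "\<bar>\<nu> * D ?y v\<bar> \<le> \<nu> * (en ?y * en v)"
    unfolding abs_mult using D_bound[OF n(3) assms(2)] \<nu>_pos by (intro mult_mono) auto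
  ultimately show ?thesis
    unfolding res_eq_update[OF assms]
    using B_ball_bound[OF n(1,4,3) assms(2)] by (simp add: abs_le_iff algebra_simps)
qed

text \<open>Testing the update equation with the update itself removes \<open>B u y y\<close>; the
  other two terms are coercive with constant \<kappa>. A bound on the residual at this single test
  function suffices.\<close>

lemma update_le_res:
  assumes "newton u w" and \<rho>: "res u (\<lambda>x. w x - u x) \<le> \<rho> * en (\<lambda>x. w x - u x)" "0 \<le> \<rho>"
  shows "\<kappa> * en (\<lambda>x. w x - u x) \<le> \<rho>"
proof -
  let ?y = "\<lambda>x. w x - u x"
  note n = newtonD[OF assms(1)]
  have "\<nu> * (en ?y * en ?y) - M * R * en ?y * en ?y \<le> res u ?y"
    unfolding res_eq_update[OF assms(1) n(3)]
    using B_ball_bound(2)[OF n(1,4,3,3)] by (simp add: B_diag en_sq)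
  then have "(\<kappa> * en ?y) * en ?y \<le> \<rho> * en ?y"
    using \<rho>(1) by (simp add: \<kappa>_def algebra_simps)
  then show ?thesis
    using \<rho>(2) en_nonneg[of ?y] by (cases "en ?y = 0") auto
qed

text \<open>Strong monotonicity of the operator \<open>-r\<close> on the ball.\<close>

lemma iterate_diff_bound:
  assumes "newton u w" "newton u' w'"
  shows "\<kappa> * en (\<lambda>x. u x - u' x) \<le> 3 * \<nu> * (en (\<lambda>x. w x - u x) + en (\<lambda>x. w' x - u' x))"
proof -
  let ?e = "\<lambda>x. u x - u' x" and ?y = "\<lambda>x. w x - u x" and ?y' = "\<lambda>x. w' x - u' x"
  note n = newtonD[OF assms(1)] and n' = newtonD[OF assms(2)]
  have e: "?e \<in> V" using n n' by (intro V_diff)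
  \<comment> \<open>The quadratic terms are regrouped so that \<open>B u ?e ?e\<close> vanishes and
    only \<open>u'\<close>, a point of the ball, multiplies two copies of the error.\<close>
  have "res u' ?e - res u ?e = B u ?e ?e + B ?e u' ?e + \<nu> * D ?e ?e"
    using e n(1) n'(1) by (simp add: res_def B_diff1 B_diff2 D_diff algebra_simps)
  then have "\<nu> * (en ?e * en ?e) - M * R * en ?e * en ?e \<le> res u' ?e - res u ?e"
    using B_ball_bound(2)[OF n'(1,4) e e] by (simp add: B_diag en_sq)
  also have "\<dots> \<le> 3 * \<nu> * en ?y * en ?e + 3 * \<nu> * en ?y' * en ?e"
    using res_bound[OF assms(1) e] res_bound[OF assms(2) e] by linarith
  finally have "(\<kappa> * en ?e) * en ?e \<le> (3 * \<nu> * (en ?y + en ?y')) * en ?e"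
    by (simp add: \<kappa>_def algebra_simps)
  moreover have "0 \<le> 3 * \<nu> * (en ?y + en ?y')" using \<nu>_pos by simp
  ultimately show ?thesis
    using en_nonneg[of ?e] by (cases "en ?e = 0") auto
qed

definition \<Lambda> :: real where "\<Lambda> = 3 * \<nu> / \<kappa> + 1"

lemma \<Lambda>_pos: "0 < \<Lambda>"
  using \<nu>_pos \<kappa>_pos by (simp add: \<Lambda>_def add_pos_pos)

text \<open>The difference of the images is the difference of the iterates plus that of the updates;
  these contribute the summands \<open>3 * \<nu> / \<kappa>\<close> and 1 of \<Lambda>.\<close>

lemma newton_diff_bound:
  assumes "newton u w" "newton u' w'"
  shows "en (\<lambda>x. w x - w' x) \<le> \<Lambda> * (en (\<lambda>x. w x - u x) + en (\<lambda>x. w' x - u' x))"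
proof -
  let ?e = "\<lambda>x. u x - u' x" and ?y = "\<lambda>x. w x - u x" and ?y' = "\<lambda>x. w' x - u' x"
  note n = newtonD[OF assms(1)] and n' = newtonD[OF assms(2)]
  have "en (\<lambda>x. w x - w' x) = en (\<lambda>x. 1 *\<^sub>R ?e x + 1 *\<^sub>R (?y x - ?y' x))"
    by (simp add: algebra_simps)
  also have "\<dots> \<le> en ?e + en (\<lambda>x. ?y x - ?y' x)"
    using en_lincomb[of ?e "\<lambda>x. ?y x - ?y' x" 1 1] n n' V_diff by simp
  also have "\<dots> \<le> en ?e + (en ?y + en ?y')"
    using en_diff_le[OF n(3) n'(3)] by simp
  also have "en ?e \<le> 3 * \<nu> * (en ?y + en ?y') / \<kappa>"
    using iterate_diff_bound[OF assms] \<kappa>_pos by (simp add: pos_le_divide_eq mult.commute)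
  finally show ?thesis by (simp add: \<Lambda>_def algebra_simps add_divide_distrib)
qed

text \<open>The first-order terms of the expansion of the residual about the combination cancel.\<close>

lemma res_affine_comb:
  assumes I: "finite I" "(\<Sum>i\<in>I. c i) = 1" and w: "\<And>i. i \<in> I \<Longrightarrow> w i \<in> V" and v: "v \<in> V"
  defines "s \<equiv> \<lambda>x. \<Sum>i\<in>I. c i *\<^sub>R w i x"
  shows "res s v = (\<Sum>i\<in>I. c i * (res (w i) v + B (\<lambda>x. w i x - s x) (\<lambda>x. w i x - s x) v))"
proof -
  have s: "s \<in> V" unfolding s_def using I w by (intro V_sum)
  have e: "res (w i) v + B (\<lambda>x. w i x - s x) (\<lambda>x. w i x - s x) v =
      f v - \<nu> * D (w i) v - B s (w i) v - B (w i) s v + B s s v" if "i \<in> I" for i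
    using w[OF that] s v by (simp add: res_def B_diff1 B_diff2 V_diff)
  have "(\<Sum>i\<in>I. c i * (res (w i) v + B (\<lambda>x. w i x - s x) (\<lambda>x. w i x - s x) v)) =
      (\<Sum>i\<in>I. c i * (f v + B s s v) - \<nu> * (c i * D (w i) v) - c i * B s (w i) v - c i * B (w i) s v)"
    by (intro sum.cong refl) (simp only: e, simp add: algebra_simps)
  also have "\<dots> = (\<Sum>i\<in>I. c i) * (f v + B s s v) - \<nu> * (\<Sum>i\<in>I. c i * D (w i) v)
      - (\<Sum>i\<in>I. c i * B s (w i) v) - (\<Sum>i\<in>I. c i * B (w i) s v)"
    by (simp add: sum_subtractf sum_distrib_left sum_distrib_right)
  also have "\<dots> = f v + B s s v - \<nu> * D s v - B s s v - B s s v"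
    using D_sum[where w = w and c = c, OF I(1) w v] B_sum1[where w = w and c = c, OF I(1) w s v]
      B_sum2[where w = w and c = c, OF I(1) w s v]
    by (simp add: I(2) s_def[symmetric])
  finally show ?thesis by (simp add: res_def)
qed

text \<open>The residual at the combination is a weighted sum of second-order terms. For each image,
  its own update gives the 1, and its distance to the combination, at most
  \<open>2 * A * \<Lambda> * T\<close>, gives \<open>4 * A\<^sup>2 * \<Lambda>\<^sup>2\<close>.
  Coercivity then costs the division by \<kappa>.\<close>

theorem update_after_mixing:
  assumes I: "finite I" "(\<Sum>i\<in>I. c i) = 1"
    and n: "\<And>i. i \<in> I \<Longrightarrow> newton (u i) (w i)"
    and T: "\<And>i. i \<in> I \<Longrightarrow> en (\<lambda>x. w i x - u i x) \<le> T"
    and s: "newton (\<lambda>x. \<Sum>i\<in>I. c i *\<^sub>R w i x) w'"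
  defines "A \<equiv> (\<Sum>i\<in>I. \<bar>c i\<bar>)"
  shows "en (\<lambda>x. w' x - (\<Sum>i\<in>I. c i *\<^sub>R w i x)) \<le> M * A * (1 + 4 * A\<^sup>2 * \<Lambda>\<^sup>2) / \<kappa> * T\<^sup>2"
proof -
  let ?s = "\<lambda>x. \<Sum>i\<in>I. c i *\<^sub>R w i x"
  have w: "w i \<in> V" if "i \<in> I" for i using newtonD(2)[OF n[OF that]] .
  have sV: "?s \<in> V" using I w by (intro V_sum)
  have A: "0 \<le> A" unfolding A_def by (intro sum_nonneg) auto
  have dev: "en (\<lambda>x. w j x - ?s x) \<le> 2 * A * \<Lambda> * T" if j: "j \<in> I" for j
  proof -
    \<comment> \<open>Since the weights sum to 1, the deviation is a weighted sum of pairwise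
      differences of images.\<close>
    have "(\<lambda>x. w j x - ?s x) = (\<lambda>x. \<Sum>i\<in>I. c i *\<^sub>R (w j x - w i x))"
      by (simp add: scaleR_diff_right sum_subtractf scaleR_left.sum[symmetric] I(2))
    then have "en (\<lambda>x. w j x - ?s x) \<le> (\<Sum>i\<in>I. \<bar>c i\<bar> * en (\<lambda>x. w j x - w i x))"
      using en_sum[OF I(1), where w = "\<lambda>i x. w j x - w i x" and c = c] w j V_diff by simp
    also have "\<dots> \<le> (\<Sum>i\<in>I. \<bar>c i\<bar> * (\<Lambda> * (T + T)))"
    proof (intro sum_mono mult_left_mono)
      fix i assume i: "i \<in> I"
      have "en (\<lambda>x. w j x - w i x) \<le> \<Lambda> * (en (\<lambda>x. w j x - u j x) + en (\<lambda>x. w i x - u i x))"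
        by (rule newton_diff_bound[OF n[OF j] n[OF i]])
      also have "\<dots> \<le> \<Lambda> * (T + T)"
        using T i j \<Lambda>_pos by (intro mult_left_mono add_mono) auto
      finally show "en (\<lambda>x. w j x - w i x) \<le> \<Lambda> * (T + T)" .
    qed auto
    also have "\<dots> = 2 * A * \<Lambda> * T"
      unfolding sum_distrib_right[symmetric] by (simp add: A_def)
    finally show ?thesis .
  qed
  let ?\<rho> = "M * A * (1 + 4 * A\<^sup>2 * \<Lambda>\<^sup>2) * T\<^sup>2"
  have "res ?s v \<le> ?\<rho> * en v" if v: "v \<in> V" for v
  proof -
    have "res ?s v = (\<Sum>i\<in>I. c i * (res (w i) v + B (\<lambda>x. w i x - ?s x) (\<lambda>x. w i x - ?s x) v))"
      by (rule res_affine_comb[OF I w v])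
    also have "\<dots> \<le> (\<Sum>i\<in>I. \<bar>c i\<bar> * (M * (1 + 4 * A\<^sup>2 * \<Lambda>\<^sup>2) * T\<^sup>2 * en v))"
    proof (intro sum_mono)
      fix i assume i: "i \<in> I"
      let ?y = "\<lambda>x. w i x - u i x" and ?d = "\<lambda>x. w i x - ?s x"
      have B: "\<bar>B z z v\<bar> \<le> M * t\<^sup>2 * en v" if "z \<in> V" "en z \<le> t" for z t
      proof -
        have "\<bar>B z z v\<bar> \<le> M * en z * en z * en v" using that v by (intro B_abs_bound)
        also have "\<dots> = M * (en z)\<^sup>2 * en v" by (simp add: power2_eq_square)
        also have "\<dots> \<le> M * t\<^sup>2 * en v"
          using that M_pos by (intro mult_right_mono mult_left_mono power_mono) auto
        finally show ?thesis .
      qed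
      have "\<bar>res (w i) v + B ?d ?d v\<bar> \<le> \<bar>B ?y ?y v\<bar> + \<bar>B ?d ?d v\<bar>"
        unfolding res_newton[OF n[OF i] v] by linarith
      also have "\<dots> \<le> M * T\<^sup>2 * en v + M * (2 * A * \<Lambda> * T)\<^sup>2 * en v"
        using B[OF newtonD(3)[OF n[OF i]] T[OF i]] B[OF V_diff[OF w[OF i] sV] dev[OF i]] by linarith
      also have "\<dots> = M * (1 + 4 * A\<^sup>2 * \<Lambda>\<^sup>2) * T\<^sup>2 * en v"
        by (simp add: power_mult_distrib algebra_simps)
      finally have "\<bar>c i\<bar> * \<bar>res (w i) v + B ?d ?d v\<bar> \<le> \<bar>c i\<bar> * (M * (1 + 4 * A\<^sup>2 * \<Lambda>\<^sup>2) * T\<^sup>2 * en v)"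
        by (intro mult_left_mono) auto
      then show "c i * (res (w i) v + B ?d ?d v) \<le> \<bar>c i\<bar> * (M * (1 + 4 * A\<^sup>2 * \<Lambda>\<^sup>2) * T\<^sup>2 * en v)"
        unfolding abs_mult[symmetric] by linarith
    qed
    also have "\<dots> = ?\<rho> * en v"
      by (simp add: A_def sum_distrib_right[symmetric])
    finally show ?thesis .
  qed
  then have "\<kappa> * en (\<lambda>x. w' x - ?s x) \<le> ?\<rho>"
    using newtonD(3)[OF s] A M_pos by (intro update_le_res[OF s]) auto
  then show ?thesis using \<kappa>_pos by (simp add: pos_le_divide_eq mult.commute)
qed

text \<open>On the ball \<open>en u \<le> R < \<nu> / M\<close>, so the convective and viscous parts
  of the residual contribute at most \<open>\<nu>\<^sup>2 / M\<close> each. The bound is the same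
  for every iterate.\<close>

lemma update_le_force:
  assumes "newton u w" and F: "f (\<lambda>x. w x - u x) \<le> F * en (\<lambda>x. w x - u x)" "0 \<le> F"
  shows "en (\<lambda>x. w x - u x) \<le> (F + 2 * \<nu>\<^sup>2 / M) / \<kappa>"
proof -
  let ?y = "\<lambda>x. w x - u x"
  note n = newtonD[OF assms(1)]
  have R: "R \<le> \<nu> / M" using R_less by simp
  have R0: "0 \<le> R" using n(4) en_nonneg[of u] by linarith
  have "\<bar>B u u ?y\<bar> \<le> M * R * en u * en ?y"
    using n by (intro B_ball_bound)
  also have "\<dots> \<le> \<nu> * (\<nu> / M) * en ?y"
    using n(4) MR_le R \<nu>_pos by (intro mult_right_mono mult_mono) auto
  finally have 1: "\<bar>B u u ?y\<bar> \<le> \<nu>\<^sup>2 / M * en ?y"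
    by (simp add: power2_eq_square)
  have "\<bar>\<nu> * D u ?y\<bar> \<le> \<nu> * (en u * en ?y)"
    unfolding abs_mult using D_bound[OF n(1,3)] \<nu>_pos by (intro mult_mono) auto
  also have "\<dots> \<le> \<nu> * (\<nu> / M * en ?y)"
    using n(4) R \<nu>_pos by (intro mult_left_mono mult_right_mono) auto
  finally have 2: "\<bar>\<nu> * D u ?y\<bar> \<le> \<nu>\<^sup>2 / M * en ?y"
    by (simp add: power2_eq_square)
  have "res u ?y \<le> (F + 2 * \<nu>\<^sup>2 / M) * en ?y"
    using 1 2 F(1) by (simp add: res_def algebra_simps abs_le_iff)
  then have "\<kappa> * en ?y \<le> F + 2 * \<nu>\<^sup>2 / M"
    using F(2) M_pos by (intro update_le_res[OF assms(1)]) auto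
  then show ?thesis using \<kappa>_pos by (simp add: pos_le_divide_eq mult.commute)
qed

text \<open>The combination is solved for its last term. The 1 comes from the combination, the sum
  of weights from the other terms, extended to include index \<open>m\<close>.\<close>

lemma en_scaled_bound_from_comb:
  fixes y :: "nat \<Rightarrow> 'a \<Rightarrow> 'b"
  assumes y: "\<And>i. i \<le> m \<Longrightarrow> y i \<in> V" and c: "c m \<noteq> 0"
    and comb: "en (\<lambda>x. \<Sum>i\<in>{..m}. c i *\<^sub>R y i x) \<le> S"
    and S: "\<And>i. i < m \<Longrightarrow> en (y i) \<le> S"
  shows "en (y m) \<le> (1 + (\<Sum>i\<in>{..m}. \<bar>c i\<bar>)) / \<bar>c m\<bar> * S"
proof -
  let ?h = "\<lambda>x. \<Sum>i\<in>{..m}. c i *\<^sub>R y i x" and ?t = "\<lambda>x. \<Sum>i\<in>{..<m}. c i *\<^sub>R y i x"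
  have S0: "0 \<le> S" using comb en_nonneg[of ?h] by linarith
  have V: "?h \<in> V" "?t \<in> V" using y by (auto intro!: V_sum)
  have "?h x = ?t x + c m *\<^sub>R y m x" for x
    by (simp flip: lessThan_Suc_atMost)
  then have "y m = (\<lambda>x. (1 / c m) *\<^sub>R ?h x + (- (1 / c m)) *\<^sub>R ?t x)"
    using c by (simp add: scaleR_add_right)
  then have "en (y m) \<le> \<bar>1 / c m\<bar> * en ?h + \<bar>- (1 / c m)\<bar> * en ?t"
    using en_lincomb[OF V, of "1 / c m" "- (1 / c m)"] by simp
  also have "\<dots> \<le> \<bar>1 / c m\<bar> * S + \<bar>- (1 / c m)\<bar> * ((\<Sum>i\<in>{..m}. \<bar>c i\<bar>) * S)"
  proof (intro add_mono mult_left_mono comb)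
    have "en ?t \<le> (\<Sum>i\<in>{..<m}. \<bar>c i\<bar> * en (y i))" using y by (intro en_sum) auto
    also have "\<dots> \<le> (\<Sum>i\<in>{..<m}. \<bar>c i\<bar> * S)" using S by (intro sum_mono mult_left_mono) auto
    also have "\<dots> \<le> (\<Sum>i\<in>{..m}. \<bar>c i\<bar> * S)" using S0 by (intro sum_mono2) auto
    finally show "en ?t \<le> (\<Sum>i\<in>{..m}. \<bar>c i\<bar>) * S" by (simp add: sum_distrib_right)
  qed auto
  finally show ?thesis by (simp add: add_divide_distrib algebra_simps)
qed

text \<open>Optimality enters through \<open>opt\<close>, the comparison with the unmixed update.
  Steps up to \<open>k + 1\<close> appear because the update being bounded starts from the mixed
  iterate \<open>u k\<close>.\<close>

theorem anderson_newton_update_bound: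
  fixes u ut y :: "nat \<Rightarrow> 'a \<Rightarrow> 'b" and \<gamma> :: "nat \<Rightarrow> real"
  assumes m: "1 \<le> m" "m < k"
    and n: "\<And>j. j \<in> {1..k+1} \<Longrightarrow> newton (u (j - 1)) (ut j)"
    and y: "\<And>j. j \<in> {1..k+1} \<Longrightarrow> y j = (\<lambda>x. ut j x - u (j - 1) x)"
    and uk: "u k = aa_comb m \<gamma> k ut"
    and opt: "en (aa_comb m \<gamma> k y) \<le> en (y k)"
    and \<gamma>: "\<gamma> m \<noteq> 0"
    and Y: "\<And>j. j \<in> {1..k+1} \<Longrightarrow> en (y j) \<le> Y"
  defines "A \<equiv> \<bar>1 - (\<Sum>i=1..m. \<gamma> i)\<bar> + (\<Sum>i=1..m. \<bar>\<gamma> i\<bar>)"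
    and "S \<equiv> (\<Sum>i=1..m. en (y (k - i + 1)))"
  shows "en (y (k + 1)) \<le> M * A * (1 + 4 * A\<^sup>2 * \<Lambda>\<^sup>2) / \<kappa> * (1 + (1 + A) / \<bar>\<gamma> m\<bar>)\<^sup>2 *
    sqrt (real m * Y) * S powr (3/2)"
proof -
  \<comment> \<open>Index 0 carries the weight of the newest image, which turns the mixing into one
    affine sum over \<open>{..m}\<close>.\<close>
  define c where "c i = (if i = 0 then 1 - (\<Sum>i=1..m. \<gamma> i) else \<gamma> i)" for i
  \<comment> \<open>\<open>P * S\<close> bounds all \<open>m + 1\<close> updates: 1 serves those
    occurring in \<open>S\<close>, the fraction serves the oldest, \<open>y (k - m)\<close>.\<close>
  define P where "P = 1 + (1 + A) / \<bar>\<gamma> m\<bar>"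
  have split: "(\<Sum>i\<in>{..m}. h i) = h 0 + (\<Sum>i=1..m. h i)" for h :: "nat \<Rightarrow> 'z::comm_monoid_add"
    by (simp add: atMost_atLeast0 sum.atLeast_Suc_atMost)
  have comb: "aa_comb m \<gamma> k z = (\<lambda>x. \<Sum>i\<in>{..m}. c i *\<^sub>R z (k - i) x)" for z :: "nat \<Rightarrow> 'a \<Rightarrow> 'b"
    unfolding split aa_comb_def by (auto simp: c_def intro!: ext sum.cong)
  have c1: "(\<Sum>i\<in>{..m}. c i) = 1"
    unfolding split by (simp add: c_def)
  have cA: "(\<Sum>i\<in>{..m}. \<bar>c i\<bar>) = A"
    unfolding split by (simp add: c_def A_def)
  have A0: "0 \<le> A" unfolding A_def by (simp add: sum_nonneg)
  have P1: "1 \<le> P" using A0 by (simp add: P_def)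
  have S0: "0 \<le> S" unfolding S_def by (simp add: sum_nonneg)
  have yV: "y j \<in> V" if "j \<in> {1..k+1}" for j
    using newtonD(3)[OF n[OF that]] y[OF that] by simp
  have yS: "en (y (k - i)) \<le> S" if "i < m" for i
  proof -
    \<comment> \<open>\<open>y (k - i)\<close> is the summand of \<open>S\<close> with index
      \<open>Suc i\<close>; \<open>m < k\<close> keeps the natural-number subtraction exact.\<close>
    have "en (y (k - Suc i + 1)) \<le> S"
      unfolding S_def using that by (intro member_le_sum) auto
    moreover have "k - Suc i + 1 = k - i" using that m by linarith
    ultimately show ?thesis by simp
  qed
  have j: "k - i \<in> {1..k+1}" if "i \<le> m" for i using that m by auto
  have "en (y (k - m)) \<le> (1 + (\<Sum>i\<in>{..m}. \<bar>c i\<bar>)) / \<bar>c m\<bar> * S"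
  proof (rule en_scaled_bound_from_comb[where y = "\<lambda>i. y (k - i)"])
    show "c m \<noteq> 0" using m \<gamma> by (simp add: c_def)
    show "en (\<lambda>x. \<Sum>i\<in>{..m}. c i *\<^sub>R y (k - i) x) \<le> S"
      using opt yS[of 0] m by (simp add: comb)
    show "y (k - i) \<in> V" if "i \<le> m" for i using yV[OF j[OF that]] .
  qed (rule yS)
  then have last: "en (y (k - m)) \<le> (1 + A) / \<bar>\<gamma> m\<bar> * S"
    using m unfolding cA by (simp add: c_def)
  have T: "en (y (k - i)) \<le> P * S" if "i \<le> m" for i
  proof (cases "i = m")
    case True
    have "(1 + A) / \<bar>\<gamma> m\<bar> * S \<le> P * S" using S0 by (intro mult_right_mono) (auto simp: P_def)
    with last True show ?thesis by simp
  next
    case False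
    then have "en (y (k - i)) \<le> 1 * S" using that yS by simp
    also have "\<dots> \<le> P * S" using P1 S0 by (intro mult_right_mono)
    finally show ?thesis .
  qed
  have "en (\<lambda>x. ut (k + 1) x - (\<Sum>i\<in>{..m}. c i *\<^sub>R ut (k - i) x)) \<le>
      M * (\<Sum>i\<in>{..m}. \<bar>c i\<bar>) * (1 + 4 * (\<Sum>i\<in>{..m}. \<bar>c i\<bar>)\<^sup>2 * \<Lambda>\<^sup>2) / \<kappa> * (P * S)\<^sup>2"
  proof (rule update_after_mixing[where u = "\<lambda>i. u (k - i - 1)"])
    show "newton (\<lambda>x. \<Sum>i\<in>{..m}. c i *\<^sub>R ut (k - i) x) (ut (k + 1))"
      using n[of "k + 1"] uk by (simp add: comb)
    show "newton (u (k - i - 1)) (ut (k - i))" if "i \<in> {..m}" for i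
      using n[OF j] that by simp
    show "en (\<lambda>x. ut (k - i) x - u (k - i - 1) x) \<le> P * S" if "i \<in> {..m}" for i
      using T[of i] y[OF j, of i] that by simp
  qed (auto simp: c1)
  then have "en (y (k + 1)) \<le> M * A * (1 + 4 * A\<^sup>2 * \<Lambda>\<^sup>2) / \<kappa> * (P * S)\<^sup>2"
    using y[of "k + 1"] uk by (simp add: cA comb)
  also have "\<dots> = M * A * (1 + 4 * A\<^sup>2 * \<Lambda>\<^sup>2) / \<kappa> * P\<^sup>2 * S\<^sup>2"
    by (simp add: power_mult_distrib)
  also have "\<dots> \<le> M * A * (1 + 4 * A\<^sup>2 * \<Lambda>\<^sup>2) / \<kappa> * P\<^sup>2 * (sqrt (real m * Y) * S powr (3/2))"
  proof (rule mult_left_mono)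
    \<comment> \<open>One half power of \<open>S\<close> is absorbed by the uniform bound on the
      updates; the power 3/2 remains.\<close>
    have "S \<le> (\<Sum>i=1..m. Y)"
      unfolding S_def using m by (intro sum_mono Y) auto
    then have "S \<le> real m * Y" by simp
    then have "sqrt S * S powr (3/2) \<le> sqrt (real m * Y) * S powr (3/2)"
      by (intro mult_right_mono) auto
    moreover have "S\<^sup>2 = sqrt S * S powr (3/2)"
    proof (cases "S = 0")
      case False
      then have "S\<^sup>2 = S powr (1/2 + 3/2)" using S0 by (simp add: powr_numeral)
      then show ?thesis using S0 by (simp only: powr_add powr_half_sqrt)
    qed simp
    ultimately show "S\<^sup>2 \<le> sqrt (real m * Y) * S powr (3/2)" by simp
    show "0 \<le> M * A * (1 + 4 * A\<^sup>2 * \<Lambda>\<^sup>2) / \<kappa> * P\<^sup>2"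
      using A0 M_pos \<kappa>_pos by simp
  qed
  finally show ?thesis by (simp add: P_def mult.assoc)
qed

end

section \<open>The discretely divergence-free space\<close>

context bounded_domain
begin

lemma Vh_lincomb:
  assumes Xh: "fin_dim_space Xh" "Xh \<subseteq> X \<Omega>" and Qh: "Qh \<subseteq> L20 \<Omega>"
    and uv: "u \<in> Vh \<Omega> Xh Qh" "v \<in> Vh \<Omega> Xh Qh"
  shows "(\<lambda>x. a *\<^sub>R u x + b *\<^sub>R v x) \<in> Vh \<Omega> Xh Qh"
proof -
  have s: "(\<lambda>x. a *\<^sub>R u x + b *\<^sub>R v x) \<in> Xh"
    using uv by (intro fin_dim_space_lincomb[OF Xh(1)]) (auto simp: Vh_def)
  have X: "u \<in> X \<Omega>" "v \<in> X \<Omega>" "(\<lambda>x. a *\<^sub>R u x + b *\<^sub>R v x) \<in> X \<Omega>"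
    using uv s Xh(2) by (auto simp: Vh_def)
  have "ip \<Omega> (divg \<Omega> (\<lambda>x. a *\<^sub>R u x + b *\<^sub>R v x)) q = 0" if "q \<in> Qh" for q
  proof -
    have "q \<in> L2 \<Omega>" using that Qh by (auto simp: L20_def)
    from ip_divg_lincomb[OF X this] show ?thesis using that uv by (simp add: Vh_def)
  qed
  with s show ?thesis by (simp add: Vh_def)
qed

text \<open>The supremum is taken in the reals, so it is an upper bound only once the quotients are
  known to be bounded; the continuity constant \<open>K\<close> provides this. It also forces
  \<open>f v = 0\<close> when the gradient norm vanishes.\<close>

lemma dual_norm_bound:
  assumes f: "dual_elem \<Omega> f" and v: "v \<in> X \<Omega>"
  shows "f v \<le> dual_norm \<Omega> f * gnorm \<Omega> v"
proof -
  obtain K where K: "\<And>v. v \<in> X \<Omega> \<Longrightarrow> \<bar>f v\<bar> \<le> K * gnorm \<Omega> v"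
    using f unfolding dual_elem_def by blast
  have g0: "0 \<le> gnorm \<Omega> w" for w
    by (auto simp: gnorm_def L2norm_def ip_def intro!: integral_nonneg_AE)
  show ?thesis
  proof (cases "gnorm \<Omega> v = 0")
    case True
    then show ?thesis using K[OF v] by simp
  next
    case False
    then have nz: "nonzero_on \<Omega> v" using gnorm_AE_zero[OF v] by blast
    have pos: "0 < gnorm \<Omega> v" using False g0[of v] by linarith
    have "f w / gnorm \<Omega> w \<le> \<bar>K\<bar>" if "w \<in> X \<Omega>" for w
    proof (cases "gnorm \<Omega> w = 0")
      case False
      then have "0 < gnorm \<Omega> w" using g0[of w] by linarith
      moreover have "f w \<le> \<bar>K\<bar> * gnorm \<Omega> w"
        using K[OF that] mult_right_mono[OF abs_ge_self[of K] g0[of w]] by linarith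
      ultimately show ?thesis by (simp add: pos_divide_le_eq)
    qed simp
    then have "bdd_above ((\<lambda>v. f v / gnorm \<Omega> v) ` {v \<in> X \<Omega>. nonzero_on \<Omega> v})"
      by (intro bdd_aboveI[of _ "\<bar>K\<bar>"]) auto
    then have "f v / gnorm \<Omega> v \<le> dual_norm \<Omega> f"
      unfolding dual_norm_def using v nz by (intro cSUP_upper) auto
    then show ?thesis using pos by (simp add: pos_divide_le_eq)
  qed
qed

lemma newton_forms_Vh:
  assumes "tri_bound \<Omega> M" "0 < \<nu>" "R < \<nu> / M"
    and Xh: "fin_dim_space Xh" "Xh \<subseteq> X \<Omega>" and Qh: "Qh \<subseteq> L20 \<Omega>"
    and "w \<in> Vh \<Omega> Xh Qh"
  shows "newton_forms (Vh \<Omega> Xh Qh) (tri \<Omega>) (\<lambda>u v. ip \<Omega> (grad \<Omega> u) (grad \<Omega> v)) M \<nu> R"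
proof -
  note lc = Vh_lincomb[OF Xh Qh]
  have X: "u \<in> X \<Omega>" if "u \<in> Vh \<Omega> Xh Qh" for u
    using that Xh(2) by (auto simp: Vh_def)
  show ?thesis
  proof
    \<comment> \<open>The zero function is obtained as a trivial combination of the given element
      \<open>w\<close>.\<close>
    show "(\<lambda>x. 0) \<in> Vh \<Omega> Xh Qh"
      using lc[OF assms(7,7), of 0 0] by simp
    show "tri \<Omega> u v w = - tri \<Omega> u w v" for u v w by (rule tri_antisym)
    show "0 \<le> ip \<Omega> (grad \<Omega> u) (grad \<Omega> u)" for u
      by (auto simp: ip_def intro!: integral_nonneg_AE)
    show "0 < M" using assms(1) by (simp add: tri_bound_def)
    show "tri \<Omega> u v w \<le> M * sqrt (ip \<Omega> (grad \<Omega> u) (grad \<Omega> u)) *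
        sqrt (ip \<Omega> (grad \<Omega> v) (grad \<Omega> v)) * sqrt (ip \<Omega> (grad \<Omega> w) (grad \<Omega> w))"
      if "u \<in> Vh \<Omega> Xh Qh" "v \<in> Vh \<Omega> Xh Qh" "w \<in> Vh \<Omega> Xh Qh" for u v w
      using assms(1) that[THEN X] by (simp add: tri_bound_def gnorm_def L2norm_def)
  qed (use assms(2,3) in \<open>auto intro!: lc tri_lincomb[OF assms(1)] ip_grad_lincomb ip_commute X\<close>)
qed

end

section \<open>The explicit constant and its application to the discrete problem\<close>

theorem theorem3p14:
  fixes M :: "real \<Rightarrow> real" and m :: nat
  assumes dim: "CARD('d::finite) = 2 \<or> CARD('d) = 3"
    and M: "\<And>\<Omega> :: (real^'d) set. flow_domain \<Omega> \<Longrightarrow> tri_bound \<Omega> (M (measure lebesgue \<Omega>))"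
    and m: "1 \<le> m"
  shows "\<exists>C :: real \<Rightarrow> real \<Rightarrow> real \<Rightarrow> ((real^'d \<Rightarrow> real^'d) \<Rightarrow> real) \<Rightarrow> real list \<Rightarrow> real \<Rightarrow> real.
    \<forall>(\<Omega> :: (real^'d) set) \<nu> R f Xh Qh u ut y \<gamma> k.
      flow_domain \<Omega> \<and> 0 < \<nu> \<and> R < \<nu> / M (measure lebesgue \<Omega>) \<and>
      dual_elem \<Omega> f \<and> M (measure lebesgue \<Omega>) * dual_norm \<Omega> f / \<nu>\<^sup>2 < 1 \<and>
      fin_dim_space Xh \<and> Xh \<subseteq> X \<Omega> \<and> fin_dim_space Qh \<and> Qh \<subseteq> L20 \<Omega> \<and> inf_sup \<Omega> Xh Qh \<and>
      m < k \<and> aa_newton \<Omega> \<nu> f (Vh \<Omega> Xh Qh) R m (k + 1) u ut y \<gamma> \<and>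
      \<gamma> k m \<noteq> 0 \<and> (\<forall>j\<le>k. u j \<in> ballV \<Omega> (Vh \<Omega> Xh Qh) R)
      \<longrightarrow> gnorm \<Omega> (y (k + 1)) \<le>
            C \<nu> (measure lebesgue \<Omega>) R f (map (\<gamma> k) [1..<m+1]) (gain \<Omega> m \<gamma> y k) *
            (\<Sum>i=1..m. gnorm \<Omega> (y (k - i + 1))) powr (3/2)"
proof -
  \<comment> \<open>The sum of \<open>gs\<close> is the sum of the mixing coefficients and
    \<open>last gs\<close> is the coefficient of the oldest image. \<open>dual_norm\<close> needs
    the domain itself, whereas \<open>C\<close> receives only its volume; the small data bound
    \<open>\<nu>\<^sup>2 / M vol\<close> takes its place.\<close>
  define C where "C \<nu> vol R (f :: (real^'d \<Rightarrow> real^'d) \<Rightarrow> real) gs (\<theta> :: real) =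
    (let \<kappa> = \<nu> - M vol * R; \<Lambda> = 3 * \<nu> / \<kappa> + 1;
         A = \<bar>1 - sum_list gs\<bar> + sum_list (map abs gs)
     in M vol * A * (1 + 4 * A\<^sup>2 * \<Lambda>\<^sup>2) / \<kappa> * (1 + (1 + A) / \<bar>last gs\<bar>)\<^sup>2 *
        sqrt (real m * ((\<nu>\<^sup>2 / M vol + 2 * \<nu>\<^sup>2 / M vol) / \<kappa>)))" for \<nu> vol R f gs \<theta>
  have "gnorm \<Omega> (y (k + 1)) \<le>
      C \<nu> (measure lebesgue \<Omega>) R f (map (\<gamma> k) [1..<m+1]) (gain \<Omega> m \<gamma> y k) *
      (\<Sum>i=1..m. gnorm \<Omega> (y (k - i + 1))) powr (3/2)"
    if \<Omega>: "flow_domain \<Omega>" and \<nu>: "0 < \<nu>" "R < \<nu> / M (measure lebesgue \<Omega>)"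
      and f: "dual_elem \<Omega> f" "M (measure lebesgue \<Omega>) * dual_norm \<Omega> f / \<nu>\<^sup>2 < 1"
      and Xh: "fin_dim_space Xh" "Xh \<subseteq> X \<Omega>" and Qh: "Qh \<subseteq> L20 \<Omega>"
      and mk: "m < k" and aa: "aa_newton \<Omega> \<nu> f (Vh \<Omega> Xh Qh) R m (k + 1) u ut y \<gamma>"
      and \<gamma>: "\<gamma> k m \<noteq> 0" and ball: "\<forall>j\<le>k. u j \<in> ballV \<Omega> (Vh \<Omega> Xh Qh) R"
    for \<Omega> :: "(real^'d) set" and \<nu> R f Xh Qh u ut y \<gamma> k
  proof -
    define \<mu> where "\<mu> = M (measure lebesgue \<Omega>)"
    let ?V = "Vh \<Omega> Xh Qh"
    interpret bounded_domain \<Omega>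
      using \<Omega> by unfold_locales (auto simp: flow_domain_def)
    have \<mu>: "tri_bound \<Omega> \<mu>" "0 < \<mu>"
      using M[OF \<Omega>] by (auto simp: \<mu>_def tri_bound_def)
    have "u 0 \<in> ?V" using ball by (simp add: ballV_def)
    then interpret newton_forms ?V "tri \<Omega>" "\<lambda>u v. ip \<Omega> (grad \<Omega> u) (grad \<Omega> v)" f \<mu> \<nu> R
      using \<mu> \<nu> Xh Qh by (intro newton_forms_Vh) (auto simp: \<mu>_def)
    have en: "en = gnorm \<Omega>"
      by (simp add: fun_eq_iff en_def gnorm_def L2norm_def)
    have y: "y j = (\<lambda>x. ut j x - u (j - 1) x)" if "j \<in> {1..k+1}" for j
      using aa that by (auto simp: aa_newton_def)
    have n: "newton (u (j - 1)) (ut j)" if "j \<in> {1..k+1}" for j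
    proof -
      have "newton_sol \<Omega> \<nu> f ?V (u (j - 1)) (ut j)"
        using aa that by (auto simp: aa_newton_def)
      \<comment> \<open>Step \<open>k + 1\<close> starts from \<open>u k\<close>, the last iterate
        assumed to lie in the ball.\<close>
      moreover have "u (j - 1) \<in> ballV \<Omega> ?V R"
        using that ball by (simp add: le_diff_conv)
      ultimately show ?thesis
        by (simp add: newton_def newton_sol_def ballV_def en)
    qed
    have "k \<in> {2..k+1}" "min (k - 1) m = m" using mk m by auto
    then have opt: "\<And>c. gnorm \<Omega> (aa_comb m (\<gamma> k) k y) \<le> gnorm \<Omega> (aa_comb m c k y)"
      and uk: "u k = aa_comb m (\<gamma> k) k ut"
      using aa unfolding aa_newton_def Let_def by metis+
    \<comment> \<open>The competitor with all coefficients zero leaves \<open>y k\<close>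
      alone.\<close>
    have opt0: "en (aa_comb m (\<gamma> k) k y) \<le> en (y k)"
      using opt[of "\<lambda>_. 0"] by (simp add: en aa_comb_def)
    have Y: "en (y j) \<le> (\<nu>\<^sup>2 / \<mu> + 2 * \<nu>\<^sup>2 / \<mu>) / \<kappa>" if j: "j \<in> {1..k+1}" for j
      unfolding y[OF j]
    proof (rule update_le_force[OF n[OF j]])
      let ?y = "\<lambda>x. ut j x - u (j - 1) x"
      have "?y \<in> X \<Omega>"
        using newtonD(3)[OF n[OF j]] Xh(2) by (auto simp: Vh_def)
      then have "f ?y \<le> dual_norm \<Omega> f * gnorm \<Omega> ?y"
        by (rule dual_norm_bound[OF f(1)])
      \<comment> \<open>This is the small data condition, solved for the norm of the
        forcing.\<close>
      also have "dual_norm \<Omega> f \<le> \<nu>\<^sup>2 / \<mu>"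
        using f(2) \<nu>(1) \<mu>(2) by (simp add: \<mu>_def[symmetric] field_simps)
      finally show "f ?y \<le> \<nu>\<^sup>2 / \<mu> * en ?y"
        using en_nonneg[of ?y] by (simp add: en mult_right_mono)
      show "0 \<le> \<nu>\<^sup>2 / \<mu>" using \<mu> by simp
    qed
    have sl: "sum_list (map h [1..<m+1]) = (\<Sum>i=1..m. h i)" for h :: "nat \<Rightarrow> real"
      by (simp only: interv_sum_list_conv_sum_set_nat set_upt Suc_eq_plus1[symmetric]
          atLeastLessThanSuc_atLeastAtMost)
    have last: "last (map (\<gamma> k) [1..<m+1]) = \<gamma> k m" using m by simp
    show ?thesis
      using anderson_newton_update_bound[OF m mk n y uk opt0 \<gamma> Y]
      unfolding C_def Let_def map_map sl last o_def \<mu>_def[symmetric] en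
      unfolding \<Lambda>_def \<kappa>_def .
  qed
  then show ?thesis by blast
qed

end
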